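(* Let $W:\mathbb{R}_+^2\to[0,1]$ be a graphex function which is regularly varying on $\mathbb{R}_+^2\setminus\{\mathbf 0\}$ with limit function $\omega$ and scaling function $h\in\mathcal{RV}_{-\alpha}$, where $\alpha>1$; that is, $\lim_{t\to\infty}W(tx,ty)/h(t)=\omega(x,y)$ for all $(x,y)\in\mathbb{R}_+^2\setminus\{\mathbf 0\}$. Let $\|\cdot\|$ be a norm on $\mathbb{R}^2$ and $\aleph=\{(x,y)\in\mathbb{R}_+^2\setminus\{\mathbf 0\}:\|(x,y)\|=1\}$. Assume that $\omega$ is bounded on $\aleph$ and that $$\lim_{t\to\infty}\sup_{(x,y)\in\aleph}\left|\frac{W(tx,ty)}{h(t)}-\omega(x,y)\right|=0.$$ Let $\mu_1(x)=\int_0^\infty W(x,y)\,dy$ and $\mu_2(x,y)=\int_0^\infty W(x,z)W(y,z)\,dz$. Then the following hold. (i) $\mu_1$ is regularly varying with tail index $-(\alpha-1)$, and $$\lim_{t\to\infty}\frac{\mu_1(tx)}{t\,h(t)}=\int_0^\infty\omega(x,y)\,dy,\qquad x>0.$$ (ii) $\mu_2$ is regularly varying on $(0,\infty)^2$ with tail index $-(2\alpha-1)$, and $$\lim_{t\to\infty}\frac{\mu_2(tx,ty)}{t\,h^2(t)}=\int_0^\infty\omega(x,z)\,\omega(y,z)\,dz,\qquad (x,y)\in(0,\infty)^2.$$ (iii) The convergence in (ii) is uniform on sets bounded away from the axes: for any fixed $\delta>0$, $$\lim_{t\to\infty}\ \sup_{x\wedge y\ge\delta}\left|\frac{\mu_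2(tx,ty)}{t\,h^2(t)}-\int_0^\infty\omega(x,z)\,\omega(y,z)\,dz\right|=0.$$
   Context: $\mathbb{R}_+=[0,\infty)$ and $x\wedge y=\min(x,y)$. A graphex function is a symmetric measurable function $W:[0,\infty)^2\to[0,1]$ such that (a) $0<\int_0^\infty\int_0^\infty W(x,y)\,dx\,dy<\infty$; (b) $\int_0^\infty W(x,x)\,dx<\infty$; (c) $\lim_{x\to0}W(x,x)$ and $\lim_{x\to\infty}W(x,x)$ both exist. The functions $\mu_1:\mathbb{R}_+\to\mathbb{R}_+$ and $\mu_2:\mathbb{R}_+^2\to\mathbb{R}_+$ are called the univariate and bivariate graphex marginals; they are understood to be finite-valued. A function $f:(0,\infty)\to(0,\infty)$ is regularly varying (at infinity) with tail index $\beta\in\mathbb{R}$, written $f\in\mathcal{RV}_\beta$, if $\lim_{t\to\infty}f(tx)/f(t)=x^\beta$ for all $x>0$. Let $\mathbb{C}\subset\mathbb{R}_+^d$ be a cone (that is, $\boldsymbol x\in\mathbb{C}$ if and only if $t\boldsymbol x\in\mathbb{C}$ for all $t>0$). A function $f:\mathbb{C}\to(0,\infty)$ is (multivariate) regularly varying on $\mathbb{C}$ with tail index $\beta$, limit function $\lambda$ (where $\lambda(\boldsymbol x)>0$ for $\boldsymbol x\in\mathbb{C}$) and scaling function $g:(0,\infty)\to(0,\infty)$, $g\in\mathcal{RV}_\beta$, if $\lim_{t\to\infty}f(t\boldsymbol x)/g(t)=\lambda(\boldsymbol x)$ for all $\boldsymbol x\in\mathbb{C}$. *)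

theory Defs
  imports "HOL-Analysis.Analysis"
begin

definition graphex_function :: "(real \<times> real \<Rightarrow> real) \<Rightarrow> bool" where
  "graphex_function W \<longleftrightarrow>
     W \<in> borel_measurable (restrict_space borel ({0..} \<times> {0..})) \<and>
     (\<forall>x\<ge>0. \<forall>y\<ge>0. 0 \<le> W (x, y) \<and> W (x, y) \<le> 1 \<and> W (x, y) = W (y, x)) \<and>
     0 < (\<integral>\<^sup>+ x\<in>{0..}. (\<integral>\<^sup>+ y\<in>{0..}. ennreal (W (x, y)) \<partial>lborel) \<partial>lborel) \<and>
     (\<integral>\<^sup>+ x\<in>{0..}. (\<integral>\<^sup>+ y\<in>{0..}. ennreal (W (x, y)) \<partial>lborel) \<partial>lborel) < \<infinity> \<and>
     (\<integral>\<^sup>+ x\<in>{0..}. ennreal (W (x, x)) \<partial>lborel) < \<infinity> \<and>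
     (\<exists>l. ((\<lambda>x. W (x, x)) \<longlongrightarrow> l) (at_right 0)) \<and>
     (\<exists>l. ((\<lambda>x. W (x, x)) \<longlongrightarrow> l) at_top)"

definition univariate_marginal :: "(real \<times> real \<Rightarrow> real) \<Rightarrow> real \<Rightarrow> real" where
  "univariate_marginal W x = (LINT y:{0..}|lborel. W (x, y))"

definition bivariate_marginal :: "(real \<times> real \<Rightarrow> real) \<Rightarrow> real \<times> real \<Rightarrow> real" where
  "bivariate_marginal W p = (LINT z:{0..}|lborel. W (fst p, z) * W (snd p, z))"

text \<open>The Bochner integrals above are \<open>0\<close> when the integrand is not integrable, so the
  convention that both marginals are finite-valued is expressed through nonnegative integrals.\<close>

definition finite_marginals :: "(real \<times> real \<Rightarrow> real) \<Rightarrow> bool" where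
  "finite_marginals W \<longleftrightarrow>
     (\<forall>x\<ge>0. (\<integral>\<^sup>+ y\<in>{0..}. ennreal (W (x, y)) \<partial>lborel) < \<infinity>) \<and>
     (\<forall>x\<ge>0. \<forall>y\<ge>0. (\<integral>\<^sup>+ z\<in>{0..}. ennreal (W (x, z) * W (y, z)) \<partial>lborel) < \<infinity>)"

definition regularly_varying :: "real \<Rightarrow> (real \<Rightarrow> real) \<Rightarrow> bool" where
  "regularly_varying \<beta> f \<longleftrightarrow>
     (\<forall>t>0. 0 < f t) \<and>
     (\<forall>x>0. ((\<lambda>t. f (t * x) / f t) \<longlongrightarrow> x powr \<beta>) at_top)"

text \<open>Unlike the library constant \<^const>\<open>cone\<close>, a cone here need not contain the origin.\<close>

definition nonneg_cone :: "'a::ordered_euclidean_space set \<Rightarrow> bool" where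
  "nonneg_cone C \<longleftrightarrow> C \<subseteq> {x. 0 \<le> x} \<and> (\<forall>x. x \<in> C \<longleftrightarrow> (\<forall>t>0. t *\<^sub>R x \<in> C))"

definition regularly_varying_on ::
  "'a::ordered_euclidean_space set \<Rightarrow> ('a \<Rightarrow> real) \<Rightarrow> real \<Rightarrow> ('a \<Rightarrow> real) \<Rightarrow> (real \<Rightarrow> real) \<Rightarrow> bool" where
  "regularly_varying_on C f \<beta> L g \<longleftrightarrow>
     nonneg_cone C \<and>
     (\<forall>x\<in>C. 0 < f x) \<and> (\<forall>x\<in>C. 0 < L x) \<and>
     regularly_varying \<beta> g \<and>
     (\<forall>x\<in>C. ((\<lambda>t. f (t *\<^sub>R x) / g t) \<longlongrightarrow> L x) at_top)"

text \<open>An arbitrary norm, not necessarily the Euclidean one of the type class.\<close>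

definition is_norm :: "('a::real_vector \<Rightarrow> real) \<Rightarrow> bool" where
  "is_norm N \<longleftrightarrow>
     (\<forall>x. 0 \<le> N x) \<and> (\<forall>x. N x = 0 \<longleftrightarrow> x = 0) \<and>
     (\<forall>a x. N (a *\<^sub>R x) = \<bar>a\<bar> * N x) \<and>
     (\<forall>x y. N (x + y) \<le> N x + N y)"

end

theory Submission
  imports Defs
begin

text \<open>
  After the substitution \<open>z \<mapsto> t z\<close>, the rescaled marginals are integrals over \<open>z\<close> of
  \<open>W (t x, t z) / h t\<close> and of products of two such factors. Pointwise these integrands converge to
  \<open>\<omega> (x, z)\<close> and \<open>\<omega> (x, z) * \<omega> (y, z)\<close>, so the theorem amounts to control of the error that is
  integrable in \<open>z\<close> and uniform in \<open>x\<close>.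

  Such control comes from polar coordinates. Writing \<open>(x, z) = s u\<close> with \<open>N u = 1\<close>,
  \<open>W (t x, t z) / h t = (W (t s u) / h (t s)) * (h (t s) / h t)\<close>. The first factor is uniformly close to
  \<open>\<omega> u\<close> by hypothesis. The second one is close to \<open>s powr (- \<alpha>)\<close>, uniformly over \<open>s \<ge> \<delta>\<close> relative to
  the slightly larger power \<open>s powr (- \<beta>)\<close>, where \<open>1 < \<beta> < \<alpha>\<close>; this is a form of Potter's bounds
  (\<open>weighted_uniform_regular_variation\<close>). Since every norm dominates a multiple of the Euclidean norm,
  the outcome is
  \<open>\<bar>W (t x, t z) / h t - \<omega> (x, z)\<bar> \<le> \<eta> * max \<delta> z powr (- \<beta>)\<close> for all \<open>x \<ge> \<delta>\<close>, all \<open>z \<ge> 0\<close> and all large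
  \<open>t\<close> (\<open>graphex_dominated_rescaling\<close>). The right-hand side is integrable in \<open>z\<close>, so integration proves
  the limits of both marginals uniformly away from the axes; the pointwise limits are special cases,
  and they imply regular variation because the limiting integrals are positive.

  Potter's bounds rest on the uniform convergence theorem, which is false for general non-measurable
  functions, and \<open>h\<close> is not assumed to be measurable. But \<open>h t\<close> is asymptotic to a constant multiple of
  the measurable function \<open>W (t, t)\<close>, so the bounds are proved for that function and transferred to \<open>h\<close>.
\<close>

section \<open>Uniform convergence and Potter bounds\<close>

text \<open>
  Additive form of the uniform convergence theorem for regularly varying functions. With
  \<open>\<phi> s = min 1 \<bar>s\<bar>\<close>, a subadditive function, the averages
  \<open>I x = \<integral>\<^sub>0\<^sup>2 \<phi> (g (x + v) - g x) dv\<close> tend to \<open>0\<close> by dominated convergence; here measurability of \<open>g\<close>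
  enters. For \<open>v \<in> {1..2}\<close> the increment \<open>g (x + u) - g x\<close> is the difference of
  \<open>g (x + v) - g x\<close> and \<open>g (x + v) - g (x + u)\<close>. Since \<open>{1..2}\<close> lies in both windows \<open>{0..2}\<close> and
  \<open>{u..u + 2}\<close> when \<open>u \<in> {0..1}\<close>, averaging over such \<open>v\<close> bounds
  \<open>\<phi> (g (x + u) - g x)\<close> by \<open>I x + I (x + u)\<close>, uniformly in \<open>u\<close>.
\<close>

lemma uniform_increments_unit_interval:
  fixes g :: "real \<Rightarrow> real"
  assumes g [measurable]: "g \<in> borel_measurable borel"
    and lim: "\<And>u. ((\<lambda>x. g (x + u) - g x) \<longlongrightarrow> 0) at_top"
    and e: "\<epsilon> > 0"
  shows "\<exists>X. \<forall>x\<ge>X. \<forall>u\<in>{0..1}. \<bar>g (x + u) - g x\<bar> \<le> \<epsilon>"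
proof -
  define \<phi> :: "real \<Rightarrow> real" where "\<phi> s = min 1 \<bar>s\<bar>" for s
  have \<phi>_meas [measurable]: "\<phi> \<in> borel_measurable borel"
    unfolding \<phi>_def by measurable
  have \<phi>_bd: "0 \<le> \<phi> s" "\<phi> s \<le> 1" for s
    by (auto simp: \<phi>_def)
  define I where "I x = (LINT v|lborel. indicator {0..2} v * \<phi> (g (x + v) - g x))" for x
  have int2: "integrable lborel (indicator {0..2} :: real \<Rightarrow> real)"
    by simp
  have int: "integrable lborel (\<lambda>v. indicator {0..2} v * \<phi> (g (x + v) - g x))" for x
    by (rule Bochner_Integration.integrable_bound[OF int2])
       (auto simp: \<phi>_bd indicator_def)
  have "(I \<longlongrightarrow> (LINT v::real|lborel. 0 :: real)) at_top"
    unfolding I_def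
  proof (rule integral_dominated_convergence_at_top[where w = "indicator {0..2::real}"])
    show "AE v in lborel. ((\<lambda>x. indicator {0..2} v * \<phi> (g (x + v) - g x)) \<longlongrightarrow> 0) at_top"
    proof (rule AE_I2)
      fix v :: real
      have "((\<lambda>x. indicator {0..2} v * \<phi> (g (x + v) - g x)) \<longlongrightarrow> indicator {0..2} v * min 1 \<bar>0\<bar>) at_top"
        unfolding \<phi>_def by (intro tendsto_intros lim)
      then show "((\<lambda>x. indicator {0..2} v * \<phi> (g (x + v) - g x)) \<longlongrightarrow> 0) at_top"
        by simp
    qed
  qed (auto simp: \<phi>_bd indicator_def)
  then have "(I \<longlongrightarrow> 0) at_top" by simp
  then have "eventually (\<lambda>x. I x < min 1 \<epsilon> / 2) at_top"
    using e by (intro order_tendstoD) auto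
  then obtain X where X: "\<And>x. x \<ge> X \<Longrightarrow> I x < min 1 \<epsilon> / 2"
    by (auto simp: eventually_at_top_linorder)
  have "\<bar>g (x + u) - g x\<bar> \<le> \<epsilon>" if x: "x \<ge> X" and u: "u \<in> {0..1}" for x u
  proof -
    let ?d = "g (x + u) - g x"
    let ?F = "\<lambda>v. indicator {0..2} (v - u) * \<phi> (g (x + u + (v - u)) - g (x + u))"
    have aff: "I (x + u) = (LINT v|lborel. ?F v)"
      unfolding I_def
      by (subst lborel_integral_real_affine[where c = 1 and t = "-u"]) (auto simp: algebra_simps)
    have intF: "integrable lborel ?F"
      using lborel_integrable_real_affine[OF int[of "x + u"], of 1 "-u"] by (simp add: algebra_simps)
    have "\<phi> ?d = (LINT v|lborel. indicator {1..2::real} v * \<phi> ?d)"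
      by simp
    also have "\<dots> \<le> (LINT v|lborel. indicator {0..2} v * \<phi> (g (x + v) - g x) + ?F v)"
    proof (rule integral_mono)
      show "indicator {1..2} v * \<phi> ?d \<le> indicator {0..2} v * \<phi> (g (x + v) - g x) + ?F v" for v
        using u by (auto simp: indicator_def \<phi>_def)
      show "integrable lborel (\<lambda>v. indicator {1..2::real} v * \<phi> ?d)"
        by simp
      show "integrable lborel (\<lambda>v. indicator {0..2} v * \<phi> (g (x + v) - g x) + ?F v)"
        by (intro Bochner_Integration.integrable_add int intF)
    qed
    also have "\<dots> = I x + I (x + u)"
      unfolding aff unfolding I_def by (rule Bochner_Integration.integral_add[OF int intF])
    also have "\<dots> < min 1 \<epsilon>"
      using X[of x] X[of "x + u"] x u by (auto simp: min_def split: if_splits)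
    finally show ?thesis by (auto simp: \<phi>_def)
  qed
  then show ?thesis by blast
qed

text \<open>
  An increment over distance \<open>u\<close> is a sum of at most \<open>u + 1\<close> increments over distance at most one,
  each of which is at most \<open>\<epsilon>\<close>.
\<close>

lemma increments_linear_bound:
  fixes g :: "real \<Rightarrow> real"
  assumes g: "g \<in> borel_measurable borel"
    and lim: "\<And>u. ((\<lambda>x. g (x + u) - g x) \<longlongrightarrow> 0) at_top"
    and e: "\<epsilon> > 0"
  shows "\<exists>X. \<forall>x\<ge>X. \<forall>y\<ge>X. \<bar>g y - g x\<bar> \<le> \<epsilon> * (\<bar>y - x\<bar> + 1)"
proof -
  obtain X where X: "\<And>x u. x \<ge> X \<Longrightarrow> 0 \<le> u \<Longrightarrow> u \<le> 1 \<Longrightarrow> \<bar>g (x + u) - g x\<bar> \<le> \<epsilon>"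
    using uniform_increments_unit_interval[OF g lim e] by (metis atLeastAtMost_iff)
  have steps: "\<bar>g (x + u) - g x\<bar> \<le> \<epsilon> * real n" if "x \<ge> X" "0 \<le> u" "u \<le> real n" for x u n
    using that
  proof (induction n arbitrary: x u)
    case (Suc n)
    show ?case
    proof (cases "u \<le> 1")
      case True
      have "\<epsilon> * 1 \<le> \<epsilon> * real (Suc n)" using e by (intro mult_left_mono) auto
      with X[of x u] True Suc.prems show ?thesis by linarith
    next
      case False
      have "\<bar>g (x + 1 + (u - 1)) - g (x + 1)\<bar> \<le> \<epsilon> * real n"
        using False Suc.prems by (intro Suc.IH) auto
      moreover have "\<bar>g (x + 1) - g x\<bar> \<le> \<epsilon>"
        using Suc.prems by (intro X) auto
      ultimately show ?thesis by (simp add: algebra_simps)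
    qed
  qed simp
  have up: "\<bar>g y - g x\<bar> \<le> \<epsilon> * (\<bar>y - x\<bar> + 1)" if "x \<ge> X" "x \<le> y" for x y
  proof -
    have "\<bar>g (x + (y - x)) - g x\<bar> \<le> \<epsilon> * real (nat \<lceil>y - x\<rceil>)"
      using that by (intro steps) (auto intro: real_nat_ceiling_ge)
    also have "\<dots> \<le> \<epsilon> * (\<bar>y - x\<bar> + 1)"
      using e that by (intro mult_left_mono) linarith+
    finally show ?thesis by simp
  qed
  have "\<bar>g y - g x\<bar> \<le> \<epsilon> * (\<bar>y - x\<bar> + 1)" if "x \<ge> X" "y \<ge> X" for x y
    using up[of x y] up[of y x] that by (cases "x \<le> y") (auto simp: abs_minus_commute)
  then show ?thesis by blast
qed

text \<open>
  Potter bounds on a logarithmic scale. Measurability, on which the uniform convergence theorem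
  depends, comes from a function \<open>f\<close> asymptotic to a multiple of \<open>h\<close>. The bound on
  increments is applied to \<open>g x = ln (f (exp x)) - \<rho> x\<close> and transferred to \<open>h\<close>, because
  \<open>ln f - ln h\<close> converges and so contributes a uniformly small error beyond some \<open>T\<close>. The argument
  \<open>t * s\<close> may be smaller than \<open>t\<close> as long as it stays beyond \<open>T\<close>.
\<close>

lemma potter_log_bound:
  fixes f h :: "real \<Rightarrow> real"
  assumes h: "regularly_varying \<rho> h"
    and meas: "(\<lambda>x. f (exp x)) \<in> borel_measurable borel"
    and f_pos: "\<And>t. t > 0 \<Longrightarrow> f t > 0"
    and equiv: "((\<lambda>t. f t / h t) \<longlongrightarrow> c) at_top" and c: "c > 0"
    and e: "\<epsilon> > 0"
  shows "\<exists>T>0. \<forall>t\<ge>T. \<forall>s>0. t * s \<ge> T \<longrightarrow>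
           \<bar>ln (h (t * s) / h t) - \<rho> * ln s\<bar> \<le> \<epsilon> * (\<bar>ln s\<bar> + 1)"
proof -
  have h_pos: "h t > 0" if "t > 0" for t
    using h that by (auto simp: regularly_varying_def)
  have h_lim: "((\<lambda>t. h (t * x) / h t) \<longlongrightarrow> x powr \<rho>) at_top" if "x > 0" for x
    using h that by (auto simp: regularly_varying_def)
  define l where "l t = ln (f t / h t)" for t
  have l_lim: "(l \<longlongrightarrow> ln c) at_top"
    unfolding l_def using c by (intro tendsto_ln equiv) auto
  define g where "g x = ln (f (exp x)) - \<rho> * x" for x
  have g_meas: "g \<in> borel_measurable borel"
    unfolding g_def using meas by measurable
  have g_eq: "g x = ln (h (exp x)) - \<rho> * x + l (exp x)" for x
    unfolding g_def l_def using f_pos[of "exp x"] h_pos[of "exp x"] by (simp add: ln_div)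
  have exp_top: "filterlim (\<lambda>x. exp (x + u)) at_top at_top" for u :: real
    by (rule filterlim_compose[OF exp_at_top])
       (subst add.commute, rule filterlim_tendsto_add_at_top[OF tendsto_const filterlim_ident])
  have g_lim: "((\<lambda>x. g (x + u) - g x) \<longlongrightarrow> 0) at_top" for u
  proof -
    have 1: "((\<lambda>x. ln (h (exp x * exp u) / h (exp x))) \<longlongrightarrow> ln (exp u powr \<rho>)) at_top"
      by (intro tendsto_ln filterlim_compose[OF h_lim exp_at_top]) auto
    have 2: "((\<lambda>x. l (exp (x + u)) - l (exp (x + 0))) \<longlongrightarrow> ln c - ln c) at_top"
      by (intro tendsto_diff filterlim_compose[OF l_lim exp_top])
    have "((\<lambda>x. ln (h (exp x * exp u) / h (exp x)) - \<rho> * u + (l (exp (x + u)) - l (exp (x + 0))))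
             \<longlongrightarrow> ln (exp u powr \<rho>) - \<rho> * u + (ln c - ln c)) at_top"
      by (intro tendsto_intros 1 2)
    also have "(\<lambda>x. ln (h (exp x * exp u) / h (exp x)) - \<rho> * u + (l (exp (x + u)) - l (exp (x + 0))))
                 = (\<lambda>x. g (x + u) - g x)"
      unfolding g_eq exp_add[symmetric] by (intro ext) (simp add: ln_div h_pos less_imp_neq[OF h_pos, symmetric] algebra_simps)
    finally show ?thesis by (simp add: ln_powr)
  qed
  obtain X where X: "\<And>x y. x \<ge> X \<Longrightarrow> y \<ge> X \<Longrightarrow> \<bar>g y - g x\<bar> \<le> \<epsilon> / 2 * (\<bar>y - x\<bar> + 1)"
    using increments_linear_bound[OF g_meas g_lim, of "\<epsilon> / 2"] e by auto
  obtain T0 where T0: "\<And>t. t \<ge> T0 \<Longrightarrow> \<bar>l t - ln c\<bar> < \<epsilon> / 4"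
    using tendstoD[OF l_lim, of "\<epsilon> / 4"] e by (auto simp: eventually_at_top_linorder dist_real_def)
  have "\<bar>ln (h (t * s) / h t) - \<rho> * ln s\<bar> \<le> \<epsilon> * (\<bar>ln s\<bar> + 1)"
    if t: "t \<ge> max (exp X) T0" and s: "s > 0" and ts: "t * s \<ge> max (exp X) T0" for t s
  proof -
    have t0: "t > 0" using t exp_gt_zero[of X] by linarith
    have "X \<le> ln t" "X \<le> ln (t * s)"
      using t ts t0 s by (auto simp: ln_ge_iff)
    from X[OF this] have "\<bar>g (ln (t * s)) - g (ln t)\<bar> \<le> \<epsilon> / 2 * (\<bar>ln s\<bar> + 1)"
      using t0 s by (simp add: ln_mult)
    moreover have "g (ln (t * s)) - g (ln t) = ln (h (t * s) / h t) - \<rho> * ln s + (l (t * s) - l t)"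
    proof -
      have "exp (ln (t * s)) = t * s" "exp (ln t) = t" using t0 s by auto
      then show ?thesis
        using t0 s h_pos[of t] h_pos[of "t * s"]
        unfolding g_eq by (simp only:) (simp add: ln_mult ln_div algebra_simps)
    qed
    moreover have "\<bar>l (t * s) - l t\<bar> \<le> \<epsilon> / 2"
    proof -
      have "t \<ge> T0" "t * s \<ge> T0" using t ts by auto
      from T0[OF this(1)] T0[OF this(2)] show ?thesis by linarith
    qed
    moreover have "\<epsilon> / 2 \<le> \<epsilon> / 2 * (\<bar>ln s\<bar> + 1)" using e by (simp add: algebra_simps)
    moreover have "\<epsilon> / 2 * (\<bar>ln s\<bar> + 1) + \<epsilon> / 2 * (\<bar>ln s\<bar> + 1) = \<epsilon> * (\<bar>ln s\<bar> + 1)"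
      by (simp add: algebra_simps)
    ultimately show ?thesis by linarith
  qed
  moreover have "max (exp X) T0 > 0" by (simp add: less_max_iff_disj)
  ultimately show ?thesis by blast
qed

text \<open>
  Convergence \<open>h (t s) / h t \<longlonglongrightarrow> s\<^sup>\<rho>\<close> is uniform over the unbounded range \<open>s \<ge> \<delta>\<close> once the error is
  measured relative to \<open>s powr (\<rho> + \<epsilon>)\<close>: by the Potter bound the relative error is
  \<open>exp y - 1\<close> with \<open>\<bar>y\<bar> \<le> \<kappa> v\<close> and \<open>v = \<bar>ln s\<bar> + 1\<close>, hence at most
  \<open>\<kappa> v exp (\<kappa> v) \<le> \<kappa> (2 / \<epsilon>) exp (\<epsilon> v)\<close> if \<open>\<kappa> \<le> \<epsilon> / 2\<close>, and \<open>exp (\<epsilon> v)\<close> is at most a constant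
  times \<open>s powr \<epsilon>\<close> because \<open>\<bar>ln s\<bar> \<le> ln s + 2 \<bar>ln \<delta>\<bar>\<close> for \<open>s \<ge> \<delta>\<close>.
\<close>

lemma weighted_uniform_regular_variation:
  fixes f h :: "real \<Rightarrow> real"
  assumes h: "regularly_varying \<rho> h"
    and meas: "(\<lambda>x. f (exp x)) \<in> borel_measurable borel"
    and f_pos: "\<And>t. t > 0 \<Longrightarrow> f t > 0"
    and equiv: "((\<lambda>t. f t / h t) \<longlongrightarrow> c) at_top" and c: "c > 0"
    and e: "\<epsilon> > 0" and d: "\<delta> > 0" and n: "\<eta> > 0"
  shows "\<exists>T>0. \<forall>t\<ge>T. \<forall>s\<ge>\<delta>. \<bar>h (t * s) / h t - s powr \<rho>\<bar> \<le> \<eta> * s powr (\<rho> + \<epsilon>)"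
proof -
  have h_pos: "h t > 0" if "t > 0" for t
    using h that by (auto simp: regularly_varying_def)
  define D where "D = 2 * \<bar>ln \<delta>\<bar> + 1"
  define \<kappa> where "\<kappa> = min (\<epsilon> / 2) (\<eta> * (\<epsilon> / 2) * exp (- \<epsilon> * D))"
  have k: "\<kappa> > 0" using e n by (auto simp: \<kappa>_def)
  obtain T where T: "T > 0" "\<And>t s. t \<ge> T \<Longrightarrow> s > 0 \<Longrightarrow> t * s \<ge> T \<Longrightarrow>
           \<bar>ln (h (t * s) / h t) - \<rho> * ln s\<bar> \<le> \<kappa> * (\<bar>ln s\<bar> + 1)"
    using potter_log_bound[OF h meas f_pos equiv c k] by blast
  have "\<bar>h (t * s) / h t - s powr \<rho>\<bar> \<le> \<eta> * s powr (\<rho> + \<epsilon>)"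
    if t: "t \<ge> max T (T / \<delta>)" and s: "s \<ge> \<delta>" for t s
  proof -
    have s0: "s > 0" and t0: "t > 0" using s d t T(1) by auto
    have "T / \<delta> * \<delta> \<le> t * s" using t s d T(1) t0 by (intro mult_mono) auto
    then have ts: "T \<le> t * s" using d by simp
    define y where "y = ln (h (t * s) / h t) - \<rho> * ln s"
    define v where "v = \<bar>ln s\<bar> + 1"
    have v: "v \<ge> 1" by (simp add: v_def)
    have y: "\<bar>y\<bar> \<le> \<kappa> * v" unfolding y_def v_def using t s0 ts by (intro T(2)) auto
    have "ln \<delta> \<le> ln s" using s d by simp
    then have vD: "v \<le> ln s + D" by (auto simp: v_def D_def)
    have ratio: "h (t * s) / h t = s powr \<rho> * exp y"
      using h_pos[of t] h_pos[of "t * s"] s0 t0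
      by (simp add: y_def exp_diff powr_def)
    have "\<bar>exp y - 1\<bar> \<le> \<kappa> * v * exp (\<kappa> * v)"
    proof -
      have kv: "0 \<le> \<kappa> * v" using k v by simp
      have 1: "1 + y \<le> exp y" "1 + (- (\<kappa> * v)) \<le> exp (- (\<kappa> * v))" by (rule exp_ge_add_one_self)+
      have "exp y \<le> exp (\<kappa> * v)" using y by simp
      moreover have "(1 + (- (\<kappa> * v))) * exp (\<kappa> * v) \<le> exp (- (\<kappa> * v)) * exp (\<kappa> * v)"
        using 1 by (intro mult_right_mono) auto
      then have "exp (\<kappa> * v) - 1 \<le> \<kappa> * v * exp (\<kappa> * v)"
        by (simp add: exp_minus algebra_simps)
      moreover have "\<kappa> * v * 1 \<le> \<kappa> * v * exp (\<kappa> * v)"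
        using kv by (intro mult_left_mono) auto
      ultimately show ?thesis using y 1 by linarith
    qed
    also have "\<dots> \<le> \<kappa> * v * exp (\<epsilon> / 2 * v)"
      using k v by (intro mult_left_mono) (auto simp: \<kappa>_def intro!: mult_right_mono)
    also have "\<dots> \<le> \<kappa> * (2 / \<epsilon> * exp (\<epsilon> / 2 * v)) * exp (\<epsilon> / 2 * v)"
    proof -
      have "\<epsilon> / 2 * v \<le> exp (\<epsilon> / 2 * v)" using exp_ge_add_one_self[of "\<epsilon> / 2 * v"] by linarith
      then have "v \<le> 2 / \<epsilon> * exp (\<epsilon> / 2 * v)" using e by (simp add: field_simps)
      then show ?thesis using k by (intro mult_right_mono mult_left_mono) auto
    qed
    also have "\<dots> = \<kappa> * (2 / \<epsilon>) * exp (\<epsilon> * v)"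
      by (simp add: exp_add[symmetric] mult.assoc)
    also have "\<dots> \<le> \<eta> * (\<epsilon> / 2) * exp (- \<epsilon> * D) * (2 / \<epsilon>) * exp (\<epsilon> * (ln s + D))"
      using k e vD by (intro mult_mono) (auto simp: \<kappa>_def n less_imp_le)
    also have "\<dots> = \<eta> * s powr \<epsilon>"
      using e s0 by (simp add: powr_def exp_add[symmetric] exp_minus field_simps exp_diff)
    finally have main: "\<bar>exp y - 1\<bar> \<le> \<eta> * s powr \<epsilon>" .
    have "\<bar>h (t * s) / h t - s powr \<rho>\<bar> = s powr \<rho> * \<bar>exp y - 1\<bar>"
      proof -
      have "s powr \<rho> * exp y - s powr \<rho> = s powr \<rho> * (exp y - 1)" by (simp add: algebra_simps)
      then show ?thesis unfolding ratio by (simp add: abs_mult)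
    qed
    also have "\<dots> \<le> s powr \<rho> * (\<eta> * s powr \<epsilon>)"
      using main by (intro mult_left_mono) auto
    finally show ?thesis by (simp add: powr_add mult_ac)
  qed
  then show ?thesis using T(1) by (intro exI[of _ "max T (T / \<delta>)"]) auto
qed

lemma regularly_varying_mult_power:
  assumes "regularly_varying \<rho> h"
  shows "regularly_varying (real n * \<rho> + 1) (\<lambda>t. t * h t ^ n)"
  unfolding regularly_varying_def
proof (intro conjI allI impI)
  fix t :: real assume "t > 0"
  then show "t * h t ^ n > 0" using assms by (auto simp: regularly_varying_def)
next
  fix x :: real assume x: "x > 0"
  have "((\<lambda>t. x * (h (t * x) / h t) ^ n) \<longlongrightarrow> x * (x powr \<rho>) ^ n) at_top"
    using assms x by (intro tendsto_intros) (auto simp: regularly_varying_def)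
  moreover have "x * (x powr \<rho>) ^ n = x powr (real n * \<rho> + 1)"
    using x by (simp add: powr_add powr_power mult.commute)
  moreover have "\<forall>\<^sub>F t in at_top. x * (h (t * x) / h t) ^ n = t * x * h (t * x) ^ n / (t * h t ^ n)"
    using eventually_gt_at_top[of 0] by eventually_elim (simp add: power_divide)
  ultimately show "((\<lambda>t. t * x * h (t * x) ^ n / (t * h t ^ n)) \<longlongrightarrow> x powr (real n * \<rho> + 1)) at_top"
    by (auto elim: Lim_transform_eventually)
qed

text \<open>
  Regular variation passes to every positive function that is asymptotically a positive multiple. It
  gives the regular variation of the univariate marginal from its limit at the single point \<open>x = 1\<close>,
  without computing how the limiting integral scales in \<open>x\<close>.
\<close>

lemma regularly_varying_equiv:
  assumes g: "regularly_varying \<rho> g"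
    and f_pos: "\<And>t. t > 0 \<Longrightarrow> f t > 0"
    and lim: "((\<lambda>t. f t / g t) \<longlongrightarrow> c) at_top" and c: "c > 0"
  shows "regularly_varying \<rho> f"
  unfolding regularly_varying_def
proof (intro conjI allI impI)
  fix x :: real assume x: "x > 0"
  have g_pos: "g t > 0" if "t > 0" for t using g that by (auto simp: regularly_varying_def)
  have top: "filterlim (\<lambda>t. t * x) at_top at_top"
    using x by (subst mult.commute) (intro filterlim_tendsto_pos_mult_at_top[OF tendsto_const _ filterlim_ident])
  have "((\<lambda>t. (f (t * x) / g (t * x)) * (g (t * x) / g t) / (f t / g t)) \<longlongrightarrow> c * x powr \<rho> / c) at_top"
    using g x c by (intro tendsto_intros filterlim_compose[OF lim top] lim) (auto simp: regularly_varying_def)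
  moreover have "\<forall>\<^sub>F t in at_top. (f (t * x) / g (t * x)) * (g (t * x) / g t) / (f t / g t) = f (t * x) / f t"
    using eventually_gt_at_top[of 0]
  proof eventually_elim
    case (elim t)
    then show ?case using g_pos[of t] g_pos[of "t * x"] f_pos[of t] x by simp
  qed
  ultimately have "((\<lambda>t. f (t * x) / f t) \<longlongrightarrow> c * x powr \<rho> / c) at_top"
    by (rule Lim_transform_eventually)
  then show "((\<lambda>t. f (t * x) / f t) \<longlongrightarrow> x powr \<rho>) at_top" using c by simp
qed (rule f_pos)

section \<open>Multivariate regular variation away from the origin\<close>

text \<open>
  Half of the equivalence of norms in finite dimension: \<open>N\<close> is Lipschitz, so it attains a minimum on
  the Euclidean unit sphere, and this minimum is positive.
\<close>

lemma is_norm_ge_norm: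
  fixes N :: "'a::euclidean_space \<Rightarrow> real"
  assumes "is_norm N"
  shows "\<exists>c>0. \<forall>p. c * norm p \<le> N p"
proof -
  have nn: "N x \<ge> 0" and zero: "N x = 0 \<longleftrightarrow> x = 0" and scale: "N (a *\<^sub>R x) = \<bar>a\<bar> * N x"
    and tri: "N (x + y) \<le> N x + N y" for x y a
    using assms by (auto simp: is_norm_def)
  have N0: "N 0 = 0" using zero by blast
  have N_sum: "N (\<Sum>b\<in>B. f b) \<le> (\<Sum>b\<in>B. N (f b))" if "finite B" for f and B :: "'a set"
    using that
  proof (induction B rule: finite_induct)
    case (insert b B)
    then show ?case using tri[of "f b" "sum f B"] by simp
  qed (simp add: N0)
  define C where "C = (\<Sum>b\<in>Basis. N b)"
  have upper: "N x \<le> C * norm x" for x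
  proof -
    have "N x = N (\<Sum>b\<in>Basis. (x \<bullet> b) *\<^sub>R b)" by (simp add: euclidean_representation)
    also have "\<dots> \<le> (\<Sum>b\<in>Basis. \<bar>x \<bullet> b\<bar> * N b)"
      using N_sum[of Basis "\<lambda>b. (x \<bullet> b) *\<^sub>R b"] by (simp add: scale)
    also have "\<dots> \<le> (\<Sum>b\<in>Basis. norm x * N b)"
      by (intro sum_mono mult_right_mono Basis_le_norm nn)
    finally show ?thesis by (simp add: C_def sum_distrib_left mult.commute)
  qed
  have lip: "\<bar>N x - N y\<bar> \<le> C * dist x y" for x y
  proof -
    have "N (y - x) = N (x - y)" using scale[of "-1" "x - y"] by simp
    then show ?thesis
      using tri[of y "x - y"] tri[of x "y - x"] upper[of "x - y"] by (simp add: dist_norm)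
  qed
  have "C \<ge> 0" unfolding C_def by (intro sum_nonneg nn)
  then have "C-lipschitz_on UNIV N"
    by (intro lipschitz_onI) (auto simp: dist_real_def lip)
  then have "continuous_on (sphere 0 1) N"
    using lipschitz_on_continuous_on continuous_on_subset by blast
  then obtain m where m: "m \<in> sphere 0 1" "\<And>x. x \<in> sphere 0 1 \<Longrightarrow> N m \<le> N x"
    using continuous_attains_inf[of "sphere (0::'a) 1" N] by auto
  have "N m > 0" using nn[of m] zero[of m] m(1) by fastforce
  moreover have "N m * norm p \<le> N p" for p
  proof (cases "p = 0")
    case False
    then have "N m \<le> N ((1 / norm p) *\<^sub>R p)" by (intro m) simp
    then show ?thesis using False unfolding scale by (simp add: field_simps)
  qed (simp add: nn)
  ultimately show ?thesis by blast
qed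

text \<open>
  In the equation, both sides are limits of \<open>f (t s p) / h t = (h (t s) / h t) * (f (t s p) / h (t s))\<close>.
\<close>

lemma limit_function_homogeneous:
  assumes rv: "regularly_varying_on C f \<rho> L h" and p: "p \<in> C" and s: "s > 0"
  shows "s *\<^sub>R p \<in> C" "L (s *\<^sub>R p) = s powr \<rho> * L p"
proof -
  show sp: "s *\<^sub>R p \<in> C" using rv p s unfolding regularly_varying_on_def nonneg_cone_def by blast
  have h_pos: "h t > 0" if "t > 0" for t
    using rv that by (auto simp: regularly_varying_on_def regularly_varying_def)
  have h_lim: "((\<lambda>t. h (t * s) / h t) \<longlongrightarrow> s powr \<rho>) at_top"
    using rv s by (auto simp: regularly_varying_on_def regularly_varying_def)
  have lim: "((\<lambda>t. f (t *\<^sub>R q) / h t) \<longlongrightarrow> L q) at_top" if "q \<in> C" for q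
    using rv that by (auto simp: regularly_varying_on_def)
  have top: "filterlim (\<lambda>t. t * s) at_top at_top"
    using s by (subst mult.commute) (intro filterlim_tendsto_pos_mult_at_top[OF tendsto_const _ filterlim_ident])
  have "((\<lambda>t. (h (t * s) / h t) * (f ((t * s) *\<^sub>R p) / h (t * s))) \<longlongrightarrow> s powr \<rho> * L p) at_top"
    by (intro tendsto_mult h_lim filterlim_compose[OF lim[OF p] top])
  moreover have "\<forall>\<^sub>F t in at_top. (h (t * s) / h t) * (f ((t * s) *\<^sub>R p) / h (t * s)) = f (t *\<^sub>R (s *\<^sub>R p)) / h t"
    using eventually_gt_at_top[of 0]
  proof eventually_elim
    case (elim t)
    then show ?case using h_pos[of "t * s"] s by simp
  qed
  ultimately have "((\<lambda>t. f (t *\<^sub>R (s *\<^sub>R p)) / h t) \<longlongrightarrow> s powr \<rho> * L p) at_top"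
    by (rule Lim_transform_eventually)
  with lim[OF sp] show "L (s *\<^sub>R p) = s powr \<rho> * L p"
    by (intro tendsto_unique[OF _ _]) auto
qed

text \<open>
  Uniform convergence on the unit sphere of \<open>N\<close> spreads to all points with \<open>N p \<ge> \<delta>\<close>, at the price
  of the weight \<open>N p powr (\<rho> + \<epsilon>)\<close>. In polar form \<open>p = s u\<close> with \<open>N u = 1\<close>, the rescaled value
  factors as \<open>f (t p) / h t = a r\<close>, where \<open>a = f (t s u) / h (t s)\<close> is uniformly close to \<open>L u\<close> and
  \<open>r = h (t s) / h t\<close> is close to \<open>s powr \<rho>\<close> in the weighted sense, while \<open>L p = s powr \<rho> * L u\<close>.
\<close>

lemma weighted_uniform_off_origin:
  fixes f L N :: "'a::ordered_euclidean_space \<Rightarrow> real"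
  assumes rv: "regularly_varying_on C f \<rho> L h"
    and N: "is_norm N"
    and A: "A = {p \<in> C. N p = 1}"
    and bdd: "bounded (L ` A)"
    and unif: "((\<lambda>t. SUP p\<in>A. ennreal \<bar>f (t *\<^sub>R p) / h t - L p\<bar>) \<longlongrightarrow> 0) at_top"
    and ratio: "\<And>\<eta>. \<eta> > 0 \<Longrightarrow>
      \<exists>T>0. \<forall>t\<ge>T. \<forall>s\<ge>\<delta>. \<bar>h (t * s) / h t - s powr \<rho>\<bar> \<le> \<eta> * s powr (\<rho> + \<epsilon>)"
    and e: "\<epsilon> > 0" and d: "\<delta> > 0"
  shows "\<exists>M>0. \<forall>p\<in>C. N p \<ge> \<delta> \<longrightarrow> \<bar>L p\<bar> \<le> M * N p powr (\<rho> + \<epsilon>)"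
    and "\<eta> > 0 \<Longrightarrow> \<exists>T>0. \<forall>t\<ge>T. \<forall>p\<in>C. N p \<ge> \<delta> \<longrightarrow>
           \<bar>f (t *\<^sub>R p) / h t - L p\<bar> \<le> \<eta> * N p powr (\<rho> + \<epsilon>)"
proof -
  have h_pos: "h t > 0" if "t > 0" for t
    using rv that by (auto simp: regularly_varying_on_def regularly_varying_def)
  obtain K where K: "K > 0" "\<And>p. p \<in> A \<Longrightarrow> \<bar>L p\<bar> \<le> K"
    using bdd by (auto simp: bounded_pos)
  have polar: "\<exists>u\<in>A. p = N p *\<^sub>R u" if "p \<in> C" "N p \<ge> \<delta>" for p
  proof (intro bexI)
    have "N p > 0" using that d by simp
    have "N ((1 / N p) *\<^sub>R p) = \<bar>1 / N p\<bar> * N p" using N unfolding is_norm_def by blast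
    with \<open>N p > 0\<close> have "(1 / N p) *\<^sub>R p \<in> C" "N ((1 / N p) *\<^sub>R p) = 1"
      using limit_function_homogeneous(1)[OF rv that(1), of "1 / N p"] by auto
    then show "(1 / N p) *\<^sub>R p \<in> A" unfolding A by simp
    show "p = N p *\<^sub>R ((1 / N p) *\<^sub>R p)" using \<open>N p > 0\<close> by simp
  qed
  \<comment> \<open>Away from the origin the larger exponent \<open>\<rho> + \<epsilon>\<close> dominates \<open>\<rho>\<close>.\<close>
  have weight: "s powr \<rho> \<le> \<delta> powr (-\<epsilon>) * s powr (\<rho> + \<epsilon>)" if "s \<ge> \<delta>" for s
  proof -
    have "s powr (-\<epsilon>) \<le> \<delta> powr (-\<epsilon>)"
      using that d e by (intro powr_mono2') auto
    then have "s powr (-\<epsilon>) * s powr (\<rho> + \<epsilon>) \<le> \<delta> powr (-\<epsilon>) * s powr (\<rho> + \<epsilon>)"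
      by (intro mult_right_mono) auto
    then show ?thesis by (simp add: powr_add[symmetric])
  qed
  show "\<exists>M>0. \<forall>p\<in>C. N p \<ge> \<delta> \<longrightarrow> \<bar>L p\<bar> \<le> M * N p powr (\<rho> + \<epsilon>)"
  proof (intro exI conjI ballI impI)
    show "K * \<delta> powr (-\<epsilon>) > 0" using K d by simp
    fix p assume p: "p \<in> C" "N p \<ge> \<delta>"
    then obtain u where u: "u \<in> A" "p = N p *\<^sub>R u" using polar by blast
    then have "L p = N p powr \<rho> * L u"
      using limit_function_homogeneous(2)[OF rv, of u "N p"] p d by (auto simp: A)
    then have "\<bar>L p\<bar> = N p powr \<rho> * \<bar>L u\<bar>" by (simp add: abs_mult)
    also have "\<dots> \<le> (\<delta> powr (-\<epsilon>) * N p powr (\<rho> + \<epsilon>)) * K"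
      using weight[OF p(2)] K(2)[OF u(1)] by (intro mult_mono) auto
    finally show "\<bar>L p\<bar> \<le> K * \<delta> powr (-\<epsilon>) * N p powr (\<rho> + \<epsilon>)" by (simp add: mult_ac)
  qed
  assume n: "\<eta> > 0"
  define B where "B = \<delta> powr (-\<epsilon>) + 1 + K"
  have B: "B > 0" using K by (simp add: B_def add_nonneg_pos)
  define \<kappa> where "\<kappa> = min 1 (\<eta> / B)"
  have k: "\<kappa> > 0" "\<kappa> \<le> 1" "\<kappa> * B \<le> \<eta>"
    using n B by (auto simp: \<kappa>_def min_def field_simps)
  obtain T1 where T1: "T1 > 0" "\<And>t s. t \<ge> T1 \<Longrightarrow> s \<ge> \<delta> \<Longrightarrow> \<bar>h (t * s) / h t - s powr \<rho>\<bar> \<le> \<kappa> * s powr (\<rho> + \<epsilon>)"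
    using ratio[OF k(1)] by blast
  have "\<forall>\<^sub>F t in at_top. (SUP p\<in>A. ennreal \<bar>f (t *\<^sub>R p) / h t - L p\<bar>) < ennreal \<kappa>"
    using k by (intro order_tendstoD[OF unif]) auto
  then obtain T2 where T2: "\<And>t. t \<ge> T2 \<Longrightarrow> (SUP p\<in>A. ennreal \<bar>f (t *\<^sub>R p) / h t - L p\<bar>) < ennreal \<kappa>"
    by (auto simp: eventually_at_top_linorder)
  have near: "\<bar>f (t *\<^sub>R u) / h t - L u\<bar> \<le> \<kappa>" if "t \<ge> T2" "u \<in> A" for t u
  proof -
    have "ennreal \<bar>f (t *\<^sub>R u) / h t - L u\<bar> \<le> ennreal \<kappa>"
      using SUP_upper[OF that(2), of "\<lambda>p. ennreal \<bar>f (t *\<^sub>R p) / h t - L p\<bar>"] T2[OF that(1)]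
      by (meson le_less_trans less_imp_le)
    then show ?thesis using k by (simp add: ennreal_le_iff)
  qed
  show "\<exists>T>0. \<forall>t\<ge>T. \<forall>p\<in>C. N p \<ge> \<delta> \<longrightarrow> \<bar>f (t *\<^sub>R p) / h t - L p\<bar> \<le> \<eta> * N p powr (\<rho> + \<epsilon>)"
  proof (intro exI[of _ "max T1 (T2 / \<delta>)"] conjI allI ballI impI)
    show "max T1 (T2 / \<delta>) > 0" using T1 by auto
    fix t p assume t: "t \<ge> max T1 (T2 / \<delta>)" and p: "p \<in> C" "N p \<ge> \<delta>"
    define s where "s = N p"
    have s: "s \<ge> \<delta>" "s > 0" using p d by (auto simp: s_def)
    obtain u where u: "u \<in> A" "p = s *\<^sub>R u" using polar p unfolding s_def by blast
    have t0: "t > 0" using t T1 by auto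
    have "T2 \<le> t * \<delta>" using t d by (simp add: field_simps)
    also have "t * \<delta> \<le> t * s" using s t0 by simp
    finally have ts: "t * s \<ge> T2" .
    define a where "a = f ((t * s) *\<^sub>R u) / h (t * s)"
    define r where "r = h (t * s) / h t"
    have a: "\<bar>a - L u\<bar> \<le> \<kappa>" unfolding a_def by (rule near[OF ts u(1)])
    have r: "\<bar>r - s powr \<rho>\<bar> \<le> \<kappa> * s powr (\<rho> + \<epsilon>)" unfolding r_def using t s by (intro T1) auto
    have r0: "r > 0" unfolding r_def using h_pos t0 s by simp
    have split: "f (t *\<^sub>R p) / h t - L p = (a - L u) * r + L u * (r - s powr \<rho>)"
    proof -
      have "f (t *\<^sub>R p) / h t = a * r"
        unfolding a_def r_def u(2) using h_pos[of "t * s"] t0 s by simp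
      moreover have "L p = s powr \<rho> * L u"
        unfolding u(2) using u(1) s A by (intro limit_function_homogeneous(2)[OF rv]) auto
      ultimately show ?thesis by (simp add: algebra_simps)
    qed
    have "r \<le> \<delta> powr (-\<epsilon>) * s powr (\<rho> + \<epsilon>) + \<kappa> * s powr (\<rho> + \<epsilon>)"
      using r weight[OF s(1)] by linarith
    also have "\<dots> \<le> (\<delta> powr (-\<epsilon>) + 1) * s powr (\<rho> + \<epsilon>)"
      using k mult_right_mono[of \<kappa> 1 "s powr (\<rho> + \<epsilon>)"] by (simp add: algebra_simps)
    finally have r_le: "r \<le> (\<delta> powr (-\<epsilon>) + 1) * s powr (\<rho> + \<epsilon>)" .
    have "\<bar>f (t *\<^sub>R p) / h t - L p\<bar> \<le> \<bar>a - L u\<bar> * r + \<bar>L u\<bar> * \<bar>r - s powr \<rho>\<bar>"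
      unfolding split using r0 by (metis abs_mult abs_of_pos abs_triangle_ineq)
    also have "\<dots> \<le> \<kappa> * ((\<delta> powr (-\<epsilon>) + 1) * s powr (\<rho> + \<epsilon>)) + K * (\<kappa> * s powr (\<rho> + \<epsilon>))"
      using a r r_le r0 k K(1) K(2)[OF u(1)] by (intro add_mono mult_mono) auto
    also have "\<dots> = \<kappa> * B * s powr (\<rho> + \<epsilon>)" by (simp add: B_def algebra_simps)
    also have "\<dots> \<le> \<eta> * s powr (\<rho> + \<epsilon>)" using k by (intro mult_right_mono) auto
    finally show "\<bar>f (t *\<^sub>R p) / h t - L p\<bar> \<le> \<eta> * N p powr (\<rho> + \<epsilon>)" by (simp add: s_def)
  qed
qed

section \<open>Integrals and suprema\<close>

lemma set_integrable_max_powr: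
  fixes \<delta> \<beta> :: real
  assumes d: "\<delta> > 0" and b: "\<beta> > 1"
  shows "set_integrable lborel {0..} (\<lambda>z. max \<delta> z powr (-\<beta>))"
proof -
  have "(\<lambda>x. x powr (-\<beta>)) absolutely_integrable_on {\<delta>..}"
    using has_integral_powr_to_inf[of "-\<beta>" \<delta>] assms
    by (subst absolutely_integrable_on_iff_nonneg) (auto simp: integrable_on_def)
  then have "set_integrable lborel {\<delta>..} (\<lambda>x. x powr (-\<beta>))"
    unfolding set_integrable_def by (subst (asm) integrable_completion) auto
  then have 1: "set_integrable lborel {\<delta>..} (\<lambda>z. max \<delta> z powr (-\<beta>))"
    by (rule set_integrable_cong[THEN iffD1, rotated -1]) (auto simp: max_def)
  have "set_integrable lborel {0..\<delta>} (\<lambda>z. \<delta> powr (-\<beta>))"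
    unfolding set_integrable_def
    by (intro integrable_scaleR_left integrable_real_indicator) (use d in auto)
  then have 2: "set_integrable lborel {0..\<delta>} (\<lambda>z. max \<delta> z powr (-\<beta>))"
    by (rule set_integrable_cong[THEN iffD1, rotated -1]) (auto simp: max_def)
  have "{0..} = {0..\<delta>} \<union> {\<delta>..}" using d by auto
  with set_integrable_Un[OF 2 1] show ?thesis by simp
qed

lemma set_integral_close:
  fixes F G Q :: "'a \<Rightarrow> real"
  assumes meas: "set_borel_measurable M S F" "set_borel_measurable M S G"
    and Q: "set_integrable M S Q"
    and G: "\<And>z. z \<in> S \<Longrightarrow> \<bar>G z\<bar> \<le> B * Q z"
    and close: "\<And>z. z \<in> S \<Longrightarrow> \<bar>F z - G z\<bar> \<le> \<eta> * Q z"
  shows "set_integrable M S F" "set_integrable M S G"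
    and "\<bar>(LINT z:S|M. F z) - (LINT z:S|M. G z)\<bar> \<le> \<eta> * (LINT z:S|M. Q z)"
proof -
  show IG: "set_integrable M S G"
    using G by (intro set_integrable_bound[OF set_integrable_mult_right[OF Q, of B] meas(2)] AE_I2)
      (auto intro: order_trans[OF _ abs_ge_self])
  have "\<bar>F z\<bar> \<le> (B + \<eta>) * Q z" if "z \<in> S" for z
    using G[OF that] close[OF that] by (simp add: algebra_simps)
  then show IF: "set_integrable M S F"
    by (intro set_integrable_bound[OF set_integrable_mult_right[OF Q, of "B + \<eta>"] meas(1)] AE_I2)
      (auto intro: order_trans[OF _ abs_ge_self])
  have ID: "set_integrable M S (\<lambda>z. F z - G z)" using IF IG by simp
  have "\<bar>(LINT z:S|M. F z) - (LINT z:S|M. G z)\<bar> = \<bar>LINT z:S|M. F z - G z\<bar>"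
    using IF IG by (simp add: set_integral_diff)
  also have "\<dots> \<le> (LINT z:S|M. \<bar>F z - G z\<bar>)"
    using set_integral_norm_bound[OF ID] by simp
  also have "\<dots> \<le> (LINT z:S|M. \<eta> * Q z)"
    using ID Q close by (intro set_integral_mono set_integrable_abs) auto
  finally show "\<bar>(LINT z:S|M. F z) - (LINT z:S|M. G z)\<bar> \<le> \<eta> * (LINT z:S|M. Q z)" by simp
qed

lemma set_integral_pos_half_line:
  fixes f :: "real \<Rightarrow> real"
  assumes int: "set_integrable lborel {0..} f" and pos: "\<And>z. z \<ge> 0 \<Longrightarrow> f z > 0"
  shows "(LINT z:{0..}|lborel. f z) > 0"
proof -
  let ?F = "\<lambda>z. indicator {0..} z *\<^sub>R f z"
  have I: "integrable lborel ?F" using int by (simp add: set_integrable_def)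
  have nn: "AE z in lborel. 0 \<le> ?F z" using pos by (auto simp: indicator_def less_imp_le)
  have "(LINT z|lborel. ?F z) \<noteq> 0"
  proof
    assume "(LINT z|lborel. ?F z) = 0"
    then have "AE z in lborel. ?F z = 0" using integral_nonneg_eq_0_iff_AE[OF I nn] by simp
    then have "AE z in lborel. z \<notin> {0..1::real}"
      using pos by (auto elim!: eventually_mono simp: indicator_def split: if_splits) (metis less_irrefl)
    then have "{0..1::real} \<in> null_sets lborel" by (simp add: AE_iff_null_sets)
    then have "emeasure lborel {0..1::real} = 0" by (rule null_setsD1)
    then show False by simp
  qed
  moreover have "(LINT z|lborel. ?F z) \<ge> 0" using nn by (rule integral_nonneg_AE)
  ultimately show ?thesis by (simp add: set_lebesgue_integral_def)
qed

lemma set_integral_half_line_scale: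
  fixes f :: "real \<Rightarrow> real"
  assumes "t > 0"
  shows "(LINT y:{0..}|lborel. f y) = t * (LINT z:{0..}|lborel. f (t * z))"
  unfolding set_lebesgue_integral_def using assms
  by (subst lborel_integral_real_affine[where c = t and t = 0])
     (auto simp: indicator_def zero_le_mult_iff intro!: Bochner_Integration.integral_cong)

lemma set_integrable_if_nn_integral_finite:
  fixes f :: "real \<Rightarrow> real"
  assumes "set_borel_measurable lborel {0..} f" "\<And>z. z \<ge> 0 \<Longrightarrow> f z \<ge> 0"
    and "(\<integral>\<^sup>+ z\<in>{0..}. ennreal (f z) \<partial>lborel) < \<infinity>"
  shows "set_integrable lborel {0..} f"
  unfolding set_integrable_def
proof (rule integrableI_nonneg)
  show "(\<lambda>z. indicator {0..} z *\<^sub>R f z) \<in> borel_measurable lborel"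
    using assms(1) by (simp add: set_borel_measurable_def)
  have "(\<integral>\<^sup>+ z. ennreal (indicator {0..} z *\<^sub>R f z) \<partial>lborel) = (\<integral>\<^sup>+ z\<in>{0..}. ennreal (f z) \<partial>lborel)"
    by (intro nn_integral_cong) (simp add: indicator_def)
  then show "(\<integral>\<^sup>+ z. ennreal (indicator {0..} z *\<^sub>R f z) \<partial>lborel) < \<infinity>" using assms(3) by simp
qed (use assms(2) in \<open>auto simp: indicator_def\<close>)

lemma set_borel_measurable_mult_real:
  fixes f g :: "'a \<Rightarrow> real"
  assumes "set_borel_measurable M S f" "set_borel_measurable M S g"
  shows "set_borel_measurable M S (\<lambda>z. f z * g z)"
proof -
  have "(\<lambda>z. (indicator S z *\<^sub>R f z) * (indicator S z *\<^sub>R g z)) \<in> borel_measurable M"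
    using assms unfolding set_borel_measurable_def by (rule borel_measurable_times)
  also have "(\<lambda>z. (indicator S z *\<^sub>R f z) * (indicator S z *\<^sub>R g z))
               = (\<lambda>z. indicator S z *\<^sub>R (f z * g z))"
    by (auto simp: indicator_def)
  finally show ?thesis by (simp add: set_borel_measurable_def)
qed

lemma set_borel_measurable_half_line_scale:
  fixes f :: "real \<Rightarrow> real"
  assumes f: "set_borel_measurable lborel {0..} f" and t: "t > 0"
  shows "set_borel_measurable lborel {0..} (\<lambda>z. f (t * z) / c)"
proof -
  have [measurable]: "(\<lambda>z. indicator {0..} z *\<^sub>R f z) \<in> borel_measurable borel"
    using f by (simp add: set_borel_measurable_def)
  have "(\<lambda>z. (indicator {0..} (t * z) *\<^sub>R f (t * z)) / c) \<in> borel_measurable borel"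
    by (rule measurable_compose[of "\<lambda>z. t * z" borel borel]) measurable
  moreover have "indicator {0..} (t * z) = (indicator {0..} z :: real)" for z
    using t by (auto simp: indicator_def zero_le_mult_iff)
  ultimately show ?thesis by (simp add: set_borel_measurable_def)
qed

lemma tendsto_at_topI_abs_le:
  fixes F :: "real \<Rightarrow> real"
  assumes "\<And>\<eta>. \<eta> > 0 \<Longrightarrow> \<exists>T. \<forall>t\<ge>T. \<bar>F t - L\<bar> \<le> \<eta>"
  shows "(F \<longlongrightarrow> L) at_top"
proof (rule tendstoI)
  fix e :: real assume "e > 0"
  then obtain T where "\<forall>t\<ge>T. \<bar>F t - L\<bar> \<le> e / 2" using assms[of "e / 2"] by auto
  with \<open>e > 0\<close> show "\<forall>\<^sub>F t in at_top. dist (F t) L < e"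
    unfolding eventually_at_top_linorder dist_real_def by (intro exI[of _ T]) force
qed

lemma SUP_ennreal_tendsto_0I:
  fixes G :: "real \<Rightarrow> 'a \<Rightarrow> real"
  assumes "\<And>\<eta>. \<eta> > 0 \<Longrightarrow> \<exists>T. \<forall>t\<ge>T. \<forall>p\<in>S. G t p \<le> \<eta>"
  shows "((\<lambda>t. SUP p\<in>S. ennreal (G t p)) \<longlongrightarrow> 0) at_top"
proof (rule order_tendstoI)
  fix a :: ennreal assume "0 < a"
  then obtain b where b: "0 < b" "b < a" using dense by blast
  \<comment> \<open>The bound \<open>a\<close> may be infinite; an intermediate \<open>b\<close> is not.\<close>
  obtain \<eta> where \<eta>: "ennreal \<eta> = b" "\<eta> > 0"
    using b by (cases b) auto
  then obtain T where T: "\<And>t p. t \<ge> T \<Longrightarrow> p \<in> S \<Longrightarrow> G t p \<le> \<eta>" using assms by blast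
  have "(SUP p\<in>S. ennreal (G t p)) < a" if "t \<ge> T" for t
    using SUP_least[of S "\<lambda>p. ennreal (G t p)" "ennreal \<eta>"] T[OF that] b(2) \<eta>(1)
    by (metis ennreal_leI order_le_less_trans)
  then show "\<forall>\<^sub>F t in at_top. (SUP p\<in>S. ennreal (G t p)) < a"
    by (auto simp: eventually_at_top_linorder)
qed simp

section \<open>Marginals of a dominated kernel\<close>

text \<open>
  The interface between the regular variation of \<open>W\<close> and its marginals. On \<open>x \<ge> \<delta>\<close>, the sections of
  \<open>\<omega>\<close> and the errors of the rescaled sections of \<open>W\<close> are controlled by the single weight
  \<open>max \<delta> z powr (- \<beta>)\<close>, which does not depend on \<open>x\<close> and is integrable in \<open>z\<close> because
  \<open>\<beta> > 1\<close>. This turns limits under the integral into uniform estimates.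
\<close>

locale dominated_rescaling =
  fixes W \<omega> :: "real \<times> real \<Rightarrow> real" and h :: "real \<Rightarrow> real" and \<beta> :: real
  assumes beta: "\<beta> > 1"
    and h_pos: "\<And>t. t > 0 \<Longrightarrow> h t > 0"
    and W_meas: "\<And>x. x \<ge> 0 \<Longrightarrow> set_borel_measurable lborel {0..} (\<lambda>z. W (x, z))"
    and \<omega>_meas: "\<And>x. x > 0 \<Longrightarrow> set_borel_measurable lborel {0..} (\<lambda>z. \<omega> (x, z))"
    and dominated: "\<And>\<delta>. \<delta> > 0 \<Longrightarrow>
          \<exists>M>0. \<forall>x\<ge>\<delta>. \<forall>z\<ge>0. \<bar>\<omega> (x, z)\<bar> \<le> M * max \<delta> z powr (-\<beta>)"
    and close: "\<And>\<delta> \<eta>. \<delta> > 0 \<Longrightarrow> \<eta> > 0 \<Longrightarrow>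
          \<exists>T>0. \<forall>t\<ge>T. \<forall>x\<ge>\<delta>. \<forall>z\<ge>0.
            \<bar>W (t * x, t * z) / h t - \<omega> (x, z)\<bar> \<le> \<eta> * max \<delta> z powr (-\<beta>)"
begin

lemma rescaled_section_measurable:
  assumes t: "t > 0" and x: "x \<ge> 0"
  shows "set_borel_measurable lborel {0..} (\<lambda>z. W (t * x, t * z) / h t)"
  using assms by (intro set_borel_measurable_half_line_scale W_meas) auto

lemma univariate_marginal_rescaled:
  assumes "t > 0"
  shows "univariate_marginal W (t * x) / (t * h t) = (LINT z:{0..}|lborel. W (t * x, t * z) / h t)"
  unfolding univariate_marginal_def
  using assms by (subst set_integral_half_line_scale[OF assms]) simp

lemma bivariate_marginal_rescaled:
  assumes "t > 0"
  shows "bivariate_marginal W (t * x, t * y) / (t * (h t)\<^sup>2)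
           = (LINT z:{0..}|lborel. (W (t * x, t * z) / h t) * (W (t * y, t * z) / h t))"
proof -
  have "(LINT z:{0..}|lborel. (W (t * x, t * z) / h t) * (W (t * y, t * z) / h t))
          = (LINT z:{0..}|lborel. W (t * x, t * z) * W (t * y, t * z)) / (h t)\<^sup>2"
    by (simp add: power2_eq_square)
  then show ?thesis
    unfolding bivariate_marginal_def fst_conv snd_conv
    using assms by (subst set_integral_half_line_scale[OF assms]) (simp only:, simp)
qed

lemma limit_section_integrable:
  assumes x: "x > 0"
  shows "set_integrable lborel {0..} (\<lambda>z. \<omega> (x, z))"
proof -
  obtain M where "\<forall>x'\<ge>x. \<forall>z\<ge>0. \<bar>\<omega> (x', z)\<bar> \<le> M * max x z powr (-\<beta>)"
    using dominated[OF x] by blast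
  then show ?thesis
    using set_integral_close(2)[OF \<omega>_meas[OF x] \<omega>_meas[OF x] set_integrable_max_powr[OF x beta], of M 0]
    by auto
qed

lemma univariate_uniform_limit:
  assumes d: "\<delta> > 0" and n: "\<eta> > 0"
  shows "\<exists>T>0. \<forall>t\<ge>T. \<forall>x\<ge>\<delta>.
    \<bar>univariate_marginal W (t * x) / (t * h t) - (LINT z:{0..}|lborel. \<omega> (x, z))\<bar> \<le> \<eta>"
proof -
  define J where "J = (LINT z:{0..}|lborel. max \<delta> z powr (-\<beta>))"
  have J: "J > 0" unfolding J_def
    using d by (intro set_integral_pos_half_line set_integrable_max_powr beta) auto
  obtain M where M: "\<And>x z. x \<ge> \<delta> \<Longrightarrow> z \<ge> 0 \<Longrightarrow> \<bar>\<omega> (x, z)\<bar> \<le> M * max \<delta> z powr (-\<beta>)"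
    using dominated[OF d] by blast
  obtain T where T: "T > 0" "\<And>t x z. t \<ge> T \<Longrightarrow> x \<ge> \<delta> \<Longrightarrow> z \<ge> 0 \<Longrightarrow>
      \<bar>W (t * x, t * z) / h t - \<omega> (x, z)\<bar> \<le> \<eta> / J * max \<delta> z powr (-\<beta>)"
    using close[OF d, of "\<eta> / J"] n J by auto
  have "\<bar>univariate_marginal W (t * x) / (t * h t) - (LINT z:{0..}|lborel. \<omega> (x, z))\<bar> \<le> \<eta>"
    if t: "t \<ge> T" and x: "x \<ge> \<delta>" for t x
  proof -
    have t0: "t > 0" and x0: "x > 0" using t x T d by auto
    have "\<bar>(LINT z:{0..}|lborel. W (t * x, t * z) / h t) - (LINT z:{0..}|lborel. \<omega> (x, z))\<bar> \<le> \<eta> / J * J"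
      by (rule set_integral_close(3)[where B = M and Q = "\<lambda>z. max \<delta> z powr (-\<beta>)" and S = "{0..}" and M = lborel,
            folded J_def])
         (use t x t0 x0 M T d beta in \<open>auto intro!: rescaled_section_measurable \<omega>_meas
            set_integrable_max_powr\<close>)
    then show ?thesis using J by (simp add: univariate_marginal_rescaled[OF t0])
  qed
  then show ?thesis using T(1) by blast
qed

lemma limit_product_bound:
  assumes d: "\<delta> > 0"
  shows "\<exists>B. \<forall>x\<ge>\<delta>. \<forall>y\<ge>\<delta>. \<forall>z\<ge>0. \<bar>\<omega> (x, z) * \<omega> (y, z)\<bar> \<le> B * max \<delta> z powr (-\<beta>)"
proof -
  obtain M where M: "M > 0" "\<And>x z. x \<ge> \<delta> \<Longrightarrow> z \<ge> 0 \<Longrightarrow> \<bar>\<omega> (x, z)\<bar> \<le> M * max \<delta> z powr (-\<beta>)"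
    using dominated[OF d] by blast
  have "\<bar>\<omega> (x, z) * \<omega> (y, z)\<bar> \<le> (M * \<delta> powr (-\<beta>) * M) * max \<delta> z powr (-\<beta>)"
    if "x \<ge> \<delta>" "y \<ge> \<delta>" "z \<ge> 0" for x y z
  proof -
    have "max \<delta> z powr (-\<beta>) \<le> \<delta> powr (-\<beta>)" using d beta by (intro powr_mono2') auto
    then have "M * max \<delta> z powr (-\<beta>) \<le> M * \<delta> powr (-\<beta>)" using M(1) by simp
    then have "\<bar>\<omega> (x, z)\<bar> \<le> M * \<delta> powr (-\<beta>)" using M(2)[of x z] that by linarith
    then have "\<bar>\<omega> (x, z)\<bar> * \<bar>\<omega> (y, z)\<bar> \<le> M * \<delta> powr (-\<beta>) * (M * max \<delta> z powr (-\<beta>))"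
      using M that by (intro mult_mono) auto
    then show ?thesis by (simp add: abs_mult mult.assoc)
  qed
  then show ?thesis by blast
qed

lemma limit_product_integrable:
  assumes x: "x > 0" and y: "y > 0"
  shows "set_integrable lborel {0..} (\<lambda>z. \<omega> (x, z) * \<omega> (y, z))"
proof -
  have d: "min x y > 0" using x y by simp
  obtain B where B: "\<And>x' y' z. x' \<ge> min x y \<Longrightarrow> y' \<ge> min x y \<Longrightarrow> z \<ge> 0 \<Longrightarrow>
      \<bar>\<omega> (x', z) * \<omega> (y', z)\<bar> \<le> B * max (min x y) z powr (-\<beta>)"
    using limit_product_bound[OF d] by blast
  have meas: "set_borel_measurable lborel {0..} (\<lambda>z. \<omega> (x, z) * \<omega> (y, z))"
    by (intro set_borel_measurable_mult_real \<omega>_meas x y)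
  show ?thesis
    using B[of x y]
    by (intro set_integral_close(2)[OF meas meas set_integrable_max_powr[OF d beta], of B 0]) auto
qed

text \<open>
  With \<open>a, b\<close> the rescaled values of \<open>W\<close> and \<open>a', b'\<close> their limits,
  \<open>a b - a' b' = (a - a') b + a' (b - b')\<close>, and each term carries two factors of the weight. One of
  them is replaced by its maximum \<open>\<delta> powr (- \<beta>)\<close>, so that the product is again controlled by the
  same weight.
\<close>

lemma product_close:
  assumes d: "\<delta> > 0" and n: "\<eta> > 0"
  shows "\<exists>T>0. \<forall>t\<ge>T. \<forall>x\<ge>\<delta>. \<forall>y\<ge>\<delta>. \<forall>z\<ge>0.
    \<bar>(W (t * x, t * z) / h t) * (W (t * y, t * z) / h t) - \<omega> (x, z) * \<omega> (y, z)\<bar>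
      \<le> \<eta> * max \<delta> z powr (-\<beta>)"
proof -
  obtain M where M: "M > 0" "\<And>x z. x \<ge> \<delta> \<Longrightarrow> z \<ge> 0 \<Longrightarrow> \<bar>\<omega> (x, z)\<bar> \<le> M * max \<delta> z powr (-\<beta>)"
    using dominated[OF d] by blast
  define D where "D = \<delta> powr (-\<beta>)"
  have D: "D > 0" using d by (simp add: D_def)
  define E where "E = (2 * M + 1) * D"
  have E: "E > 0" using M(1) D by (simp add: E_def)
  define \<kappa> where "\<kappa> = min 1 (\<eta> / E)"
  have k: "\<kappa> > 0" "\<kappa> \<le> 1" "\<kappa> * E \<le> \<eta>" using n E by (auto simp: \<kappa>_def min_def field_simps)
  obtain T where T: "T > 0" "\<And>t x z. t \<ge> T \<Longrightarrow> x \<ge> \<delta> \<Longrightarrow> z \<ge> 0 \<Longrightarrow>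
      \<bar>W (t * x, t * z) / h t - \<omega> (x, z)\<bar> \<le> \<kappa> * max \<delta> z powr (-\<beta>)"
    using close[OF d k(1)] by blast
  have "\<bar>(W (t * x, t * z) / h t) * (W (t * y, t * z) / h t) - \<omega> (x, z) * \<omega> (y, z)\<bar>
      \<le> \<eta> * max \<delta> z powr (-\<beta>)"
    if t: "t \<ge> T" and x: "x \<ge> \<delta>" and y: "y \<ge> \<delta>" and z: "z \<ge> 0" for t x y z
  proof -
    define q where "q = max \<delta> z powr (-\<beta>)"
    have q: "0 \<le> q" "q \<le> D" unfolding q_def D_def using d beta by (auto intro!: powr_mono2')
    define a b where "a = W (t * x, t * z) / h t" and "b = W (t * y, t * z) / h t"
    have ab: "\<bar>a - \<omega> (x, z)\<bar> \<le> \<kappa> * q" "\<bar>b - \<omega> (y, z)\<bar> \<le> \<kappa> * q"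
      unfolding a_def b_def q_def using T(2) t x y z by auto
    have \<omega>: "\<bar>\<omega> (x, z)\<bar> \<le> M * q" "\<bar>\<omega> (y, z)\<bar> \<le> M * q"
      unfolding q_def using M(2) x y z by auto
    have "\<kappa> * q \<le> 1 * q" using k q by (intro mult_right_mono) auto
    then have b: "\<bar>b\<bar> \<le> (M + 1) * q" using ab(2) \<omega>(2) by (simp add: algebra_simps)
    have "a * b - \<omega> (x, z) * \<omega> (y, z) = (a - \<omega> (x, z)) * b + \<omega> (x, z) * (b - \<omega> (y, z))"
      by (simp add: algebra_simps)
    then have "\<bar>a * b - \<omega> (x, z) * \<omega> (y, z)\<bar>
        \<le> \<bar>a - \<omega> (x, z)\<bar> * \<bar>b\<bar> + \<bar>\<omega> (x, z)\<bar> * \<bar>b - \<omega> (y, z)\<bar>"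
      by (metis abs_mult abs_triangle_ineq)
    also have "\<dots> \<le> (\<kappa> * q) * ((M + 1) * q) + (M * q) * (\<kappa> * q)"
      using ab \<omega> b k q M(1) by (intro add_mono mult_mono) auto
    also have "\<dots> = \<kappa> * (2 * M + 1) * q * q" by (simp add: algebra_simps)
    also have "\<dots> \<le> \<kappa> * (2 * M + 1) * D * q"
      using q k M(1) by (intro mult_right_mono mult_left_mono) auto
    also have "\<dots> \<le> \<eta> * q"
      using k(3) q(1) by (intro mult_right_mono) (auto simp: E_def mult.assoc)
    finally show ?thesis by (simp add: a_def b_def q_def)
  qed
  then show ?thesis using T(1) by blast
qed

lemma bivariate_uniform_limit:
  assumes d: "\<delta> > 0" and n: "\<eta> > 0"
  shows "\<exists>T>0. \<forall>t\<ge>T. \<forall>x\<ge>\<delta>. \<forall>y\<ge>\<delta>.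
    \<bar>bivariate_marginal W (t * x, t * y) / (t * (h t)\<^sup>2)
       - (LINT z:{0..}|lborel. \<omega> (x, z) * \<omega> (y, z))\<bar> \<le> \<eta>"
proof -
  define J where "J = (LINT z:{0..}|lborel. max \<delta> z powr (-\<beta>))"
  have J: "J > 0" unfolding J_def
    using d by (intro set_integral_pos_half_line set_integrable_max_powr beta) auto
  obtain B where B: "\<And>x y z. x \<ge> \<delta> \<Longrightarrow> y \<ge> \<delta> \<Longrightarrow> z \<ge> 0 \<Longrightarrow>
      \<bar>\<omega> (x, z) * \<omega> (y, z)\<bar> \<le> B * max \<delta> z powr (-\<beta>)"
    using limit_product_bound[OF d] by blast
  obtain T where T: "T > 0" "\<And>t x y z. t \<ge> T \<Longrightarrow> x \<ge> \<delta> \<Longrightarrow> y \<ge> \<delta> \<Longrightarrow> z \<ge> 0 \<Longrightarrow>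
      \<bar>(W (t * x, t * z) / h t) * (W (t * y, t * z) / h t) - \<omega> (x, z) * \<omega> (y, z)\<bar>
        \<le> \<eta> / J * max \<delta> z powr (-\<beta>)"
    using product_close[OF d, of "\<eta> / J"] n J by auto
  have "\<bar>bivariate_marginal W (t * x, t * y) / (t * (h t)\<^sup>2)
       - (LINT z:{0..}|lborel. \<omega> (x, z) * \<omega> (y, z))\<bar> \<le> \<eta>"
    if t: "t \<ge> T" and x: "x \<ge> \<delta>" and y: "y \<ge> \<delta>" for t x y
  proof -
    have t0: "t > 0" and x0: "x > 0" and y0: "y > 0" using t x y T(1) d by auto
    have "\<bar>bivariate_marginal W (t * x, t * y) / (t * (h t)\<^sup>2)
       - (LINT z:{0..}|lborel. \<omega> (x, z) * \<omega> (y, z))\<bar> \<le> \<eta> / J * J"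
      unfolding bivariate_marginal_rescaled[OF t0]
      unfolding J_def
    proof (rule set_integral_close(3)[where B = B])
      show "set_borel_measurable lborel {0..} (\<lambda>z. (W (t * x, t * z) / h t) * (W (t * y, t * z) / h t))"
        using x0 y0 by (intro set_borel_measurable_mult_real rescaled_section_measurable t0) auto
      show "set_borel_measurable lborel {0..} (\<lambda>z. \<omega> (x, z) * \<omega> (y, z))"
        by (intro set_borel_measurable_mult_real \<omega>_meas x0 y0)
      show "set_integrable lborel {0..} (\<lambda>z. max \<delta> z powr (-\<beta>))"
        by (rule set_integrable_max_powr[OF d beta])
    qed (use B[OF x y] T(2)[OF t x y] in \<open>auto simp flip: J_def\<close>)
    then show ?thesis using J by simp
  qed
  then show ?thesis using T(1) by blast
qed

end

section \<open>Graphex functions\<close>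

text \<open>
  The sections of the limit function are pointwise limits of rescaled sections of \<open>W\<close> along the
  integers; for each fixed integer, \<open>h\<close> enters only as a constant.
\<close>

lemma limit_function_section_measurable:
  fixes W \<omega> :: "real \<times> real \<Rightarrow> real" and h :: "real \<Rightarrow> real"
  assumes meas: "\<And>x. x \<ge> 0 \<Longrightarrow> set_borel_measurable lborel {0..} (\<lambda>z. W (x, z))"
    and lim: "\<And>z. z \<ge> 0 \<Longrightarrow> ((\<lambda>t. W (t * x, t * z) / h t) \<longlongrightarrow> \<omega> (x, z)) at_top"
    and x: "x \<ge> 0"
  shows "set_borel_measurable lborel {0..} (\<lambda>z. \<omega> (x, z))"
  unfolding set_borel_measurable_def
proof (rule borel_measurable_LIMSEQ_metric)
  fix n :: nat
  let ?t = "real (Suc n)"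
  show "(\<lambda>z. indicator {0..} z *\<^sub>R (W (?t * x, ?t * z) / h ?t)) \<in> borel_measurable lborel"
    using set_borel_measurable_half_line_scale[OF meas[of "?t * x"], of ?t "h ?t"] x
    by (simp add: set_borel_measurable_def)
next
  fix z :: real
  have top: "filterlim (\<lambda>n. real (Suc n)) at_top sequentially"
    by (intro filterlim_compose[OF filterlim_real_sequentially filterlim_Suc])
  show "(\<lambda>n. indicator {0..} z *\<^sub>R (W (real (Suc n) * x, real (Suc n) * z) / h (real (Suc n))))
          \<longlonglongrightarrow> indicator {0..} z *\<^sub>R \<omega> (x, z)"
  proof (cases "z \<ge> 0")
    case True
    then show ?thesis
      by (intro tendsto_scaleR tendsto_const filterlim_compose[OF lim top]) auto
  qed simp
qed

lemma graphex_section_measurable: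
  assumes "W \<in> borel_measurable (restrict_space borel ({0..} \<times> {0..} :: (real \<times> real) set))"
  shows "x \<ge> 0 \<Longrightarrow> set_borel_measurable lborel {0..} (\<lambda>z. W (x, z) :: real)"
    and "(\<lambda>s. W (exp s, exp s)) \<in> borel_measurable borel"
proof -
  let ?Q = "{0..} \<times> {0..} :: (real \<times> real) set"
  have "?Q \<in> sets borel"
    by (intro borel_closed closed_Times) auto
  then have W: "(\<lambda>p. indicator ?Q p *\<^sub>R W p) \<in> borel_measurable borel"
    using assms by (subst (asm) borel_measurable_restrict_space_iff) auto
  have "(\<lambda>z. indicator ?Q (x, z) *\<^sub>R W (x, z)) \<in> borel_measurable borel"
    by (rule measurable_compose[OF _ W])
      (auto intro!: borel_measurable_continuous_onI continuous_intros)
  moreover have "indicator ?Q (x, z) = (indicator {0..} z :: real)" if "x \<ge> 0" for z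
    using that by (auto simp: indicator_def)
  ultimately show "x \<ge> 0 \<Longrightarrow> set_borel_measurable lborel {0..} (\<lambda>z. W (x, z))"
    by (simp add: set_borel_measurable_def)
  have "(\<lambda>s. indicator ?Q (exp s, exp s) *\<^sub>R W (exp s, exp s)) \<in> borel_measurable borel"
    by (rule measurable_compose[OF _ W])
      (auto intro!: borel_measurable_continuous_onI continuous_intros)
  then show "(\<lambda>s. W (exp s, exp s)) \<in> borel_measurable borel"
    by (simp add: indicator_def)
qed

text \<open>
  The exponent \<open>\<beta> = (\<alpha> + 1) / 2\<close> is the midpoint between \<open>1\<close> and \<open>\<alpha>\<close>: the slack
  \<open>\<alpha> - \<beta> > 0\<close> pays for uniformity in the Potter-type estimate, and \<open>\<beta> > 1\<close> keeps the weight
  integrable. The measurable companion of \<open>h\<close> is the diagonal \<open>W (t, t)\<close>, which is asymptotic to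
  \<open>\<omega> (1, 1) * h t\<close>. Since \<open>N\<close> dominates the Euclidean norm, points \<open>(x, z)\<close> with \<open>x \<ge> \<delta>\<close> satisfy
  \<open>N (x, z) \<ge> c * max \<delta> z\<close>, which converts weights in \<open>N\<close> into weights in \<open>z\<close> alone.
\<close>

lemma graphex_dominated_rescaling:
  fixes W \<omega> N :: "real \<times> real \<Rightarrow> real" and h :: "real \<Rightarrow> real"
  assumes meas: "W \<in> borel_measurable (restrict_space borel ({0..} \<times> {0..}))"
    and \<alpha>: "\<alpha> > 1"
    and rv: "regularly_varying_on ({0..} \<times> {0..} - {(0, 0)}) W (-\<alpha>) \<omega> h"
    and N: "is_norm N"
    and A: "A = {p \<in> {0..} \<times> {0..} - {(0, 0)}. N p = 1}"
    and bdd: "bounded (\<omega> ` A)"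
    and unif: "((\<lambda>t. SUP p\<in>A. ennreal \<bar>W (t *\<^sub>R p) / h t - \<omega> p\<bar>) \<longlongrightarrow> 0) at_top"
  shows "dominated_rescaling W \<omega> h ((\<alpha> + 1) / 2)"
proof -
  let ?C = "{0..} \<times> {0..} - {(0, 0)} :: (real \<times> real) set"
  define \<epsilon> where "\<epsilon> = (\<alpha> - 1) / 2"
  define \<beta> where "\<beta> = (\<alpha> + 1) / 2"
  have eb: "\<epsilon> > 0" "\<beta> > 1" "-\<alpha> + \<epsilon> = -\<beta>" using \<alpha> by (auto simp: \<epsilon>_def \<beta>_def field_simps)
  have h: "regularly_varying (-\<alpha>) h" and W_pos: "\<And>p. p \<in> ?C \<Longrightarrow> W p > 0"
    and \<omega>_pos: "\<And>p. p \<in> ?C \<Longrightarrow> \<omega> p > 0"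
    and lim: "\<And>p. p \<in> ?C \<Longrightarrow> ((\<lambda>t. W (t *\<^sub>R p) / h t) \<longlongrightarrow> \<omega> p) at_top"
    using rv by (auto simp: regularly_varying_on_def)
  have ratio: "\<exists>T>0. \<forall>t\<ge>T. \<forall>s\<ge>\<delta>. \<bar>h (t * s) / h t - s powr (-\<alpha>)\<bar> \<le> \<eta> * s powr (-\<alpha> + \<epsilon>)"
    if "\<delta> > 0" "\<eta> > 0" for \<delta> \<eta>
  proof (rule weighted_uniform_regular_variation[OF h _ _ _ _ eb(1) that])
    show "(\<lambda>x. W (exp x, exp x)) \<in> borel_measurable borel"
      by (rule graphex_section_measurable(2)[OF meas])
    show "((\<lambda>t. W (t, t) / h t) \<longlongrightarrow> \<omega> (1, 1)) at_top"
      using lim[of "(1, 1)"] by simp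
  qed (auto intro: W_pos \<omega>_pos)
  obtain c where c: "c > 0" "\<And>p. c * norm p \<le> N p" using is_norm_ge_norm[OF N] by blast
  have N_large: "N (x, z) \<ge> c * max \<delta> z" if "x \<ge> \<delta>" "z \<ge> 0" "\<delta> > 0" for x z \<delta>
  proof -
    have "max \<delta> z \<le> norm (x, z)"
      using norm_fst_le[of x z] norm_snd_le[of z x] that by auto
    then have "c * max \<delta> z \<le> c * norm (x, z)" using c by simp
    then show ?thesis using c(2)[of "(x, z)"] by linarith
  qed
  have N_far: "N (x, z) \<ge> c * \<delta>"
    and N_weight: "N (x, z) powr (-\<beta>) \<le> c powr (-\<beta>) * max \<delta> z powr (-\<beta>)"
    if "x \<ge> \<delta>" "z \<ge> 0" "\<delta> > 0" for x z \<delta>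
  proof -
    have "c * \<delta> \<le> c * max \<delta> z" using c by simp
    then show "N (x, z) \<ge> c * \<delta>" using N_large[OF that] by linarith
    have "N (x, z) powr (-\<beta>) \<le> (c * max \<delta> z) powr (-\<beta>)"
      using N_large[OF that] c that eb by (intro powr_mono2') auto
    then show "N (x, z) powr (-\<beta>) \<le> c powr (-\<beta>) * max \<delta> z powr (-\<beta>)"
      using c that by (simp add: powr_mult)
  qed
  note off_origin = weighted_uniform_off_origin[OF rv N A bdd unif ratio eb(1), unfolded eb(3)]
  have "dominated_rescaling W \<omega> h \<beta>"
  proof
    show "\<beta> > 1" by (rule eb)
    show "h t > 0" if "t > 0" for t using h that by (auto simp: regularly_varying_def)
    show W_sec: "set_borel_measurable lborel {0..} (\<lambda>z. W (x, z))" if "x \<ge> 0" for x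
      by (rule graphex_section_measurable(1)[OF meas that])
    show "set_borel_measurable lborel {0..} (\<lambda>z. \<omega> (x, z))" if "x > 0" for x
    proof (rule limit_function_section_measurable[OF W_sec])
      show "((\<lambda>t. W (t * x, t * z) / h t) \<longlongrightarrow> \<omega> (x, z)) at_top" if "z \<ge> 0" for z
        using lim[of "(x, z)"] that \<open>x > 0\<close> by simp
    qed (use that in auto)
  next
    fix \<delta> :: real assume d: "\<delta> > 0"
    then have cd: "c * \<delta> > 0" using c by simp
    obtain M where M: "M > 0" "\<And>p. p \<in> ?C \<Longrightarrow> N p \<ge> c * \<delta> \<Longrightarrow> \<bar>\<omega> p\<bar> \<le> M * N p powr (-\<beta>)"
      using off_origin(1)[OF cd _ cd] by blast
    have "\<bar>\<omega> (x, z)\<bar> \<le> M * c powr (-\<beta>) * max \<delta> z powr (-\<beta>)" if "x \<ge> \<delta>" "z \<ge> 0" for x z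
    proof -
      have "\<bar>\<omega> (x, z)\<bar> \<le> M * N (x, z) powr (-\<beta>)"
        using that d N_far[OF that d] by (intro M) auto
      also have "\<dots> \<le> M * (c powr (-\<beta>) * max \<delta> z powr (-\<beta>))"
        using M N_weight[OF that d] by (intro mult_left_mono) auto
      finally show ?thesis by (simp add: mult.assoc)
    qed
    moreover have "M * c powr (-\<beta>) > 0" using M c by simp
    ultimately show "\<exists>M>0. \<forall>x\<ge>\<delta>. \<forall>z\<ge>0. \<bar>\<omega> (x, z)\<bar> \<le> M * max \<delta> z powr (-\<beta>)" by blast
    fix \<eta> :: real assume n: "\<eta> > 0"
    define \<kappa> where "\<kappa> = \<eta> * c powr \<beta>"
    have k: "\<kappa> > 0" "\<kappa> * c powr (-\<beta>) = \<eta>"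
      using n c by (auto simp: \<kappa>_def powr_minus)
    obtain T where T: "T > 0" "\<And>t p. t \<ge> T \<Longrightarrow> p \<in> ?C \<Longrightarrow> N p \<ge> c * \<delta> \<Longrightarrow>
        \<bar>W (t *\<^sub>R p) / h t - \<omega> p\<bar> \<le> \<kappa> * N p powr (-\<beta>)"
      using off_origin(2)[OF cd _ cd k(1)] by blast
    have "\<bar>W (t * x, t * z) / h t - \<omega> (x, z)\<bar> \<le> \<eta> * max \<delta> z powr (-\<beta>)"
      if "t \<ge> T" "x \<ge> \<delta>" "z \<ge> 0" for t x z
    proof -
      have "\<bar>W (t *\<^sub>R (x, z)) / h t - \<omega> (x, z)\<bar> \<le> \<kappa> * N (x, z) powr (-\<beta>)"
        using that d N_far[OF that(2,3) d] by (intro T) auto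
      also have "\<dots> \<le> \<kappa> * (c powr (-\<beta>) * max \<delta> z powr (-\<beta>))"
        using k N_weight[OF that(2,3) d] by (intro mult_left_mono) auto
      finally show ?thesis using k(2) by (simp add: mult.assoc[symmetric])
    qed
    with T(1) show "\<exists>T>0. \<forall>t\<ge>T. \<forall>x\<ge>\<delta>. \<forall>z\<ge>0.
            \<bar>W (t * x, t * z) / h t - \<omega> (x, z)\<bar> \<le> \<eta> * max \<delta> z powr (-\<beta>)" by blast
  qed
  then show ?thesis by (simp add: \<beta>_def)
qed

theorem theorem2p2:
  fixes W \<omega> N :: "real \<times> real \<Rightarrow> real" and h :: "real \<Rightarrow> real" and \<alpha> :: real
    and A :: "(real \<times> real) set"
  assumes "graphex_function W"
    and "finite_marginals W"
    and "\<alpha> > 1"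
    and "regularly_varying_on ({0..} \<times> {0..} - {(0, 0)}) W (-\<alpha>) \<omega> h"
    and "is_norm N"
    and "A = {p \<in> {0..} \<times> {0..} - {(0, 0)}. N p = 1}"
    and "bounded (\<omega> ` A)"
    and "((\<lambda>t. SUP p\<in>A. ennreal \<bar>W (t *\<^sub>R p) / h t - \<omega> p\<bar>) \<longlongrightarrow> 0) at_top"
  shows "(regularly_varying (-(\<alpha> - 1)) (univariate_marginal W) \<and>
     (\<forall>x>0. set_integrable lborel {0..} (\<lambda>y. \<omega> (x, y)) \<and>
        ((\<lambda>t. univariate_marginal W (t * x) / (t * h t))
           \<longlongrightarrow> (LINT y:{0..}|lborel. \<omega> (x, y))) at_top)) \<and>
    (regularly_varying_on ({0<..} \<times> {0<..}) (bivariate_marginal W) (-(2 * \<alpha> - 1))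
       (\<lambda>(x, y). LINT z:{0..}|lborel. \<omega> (x, z) * \<omega> (y, z)) (\<lambda>t. t * (h t)\<^sup>2) \<and>
     (\<forall>x>0. \<forall>y>0. set_integrable lborel {0..} (\<lambda>z. \<omega> (x, z) * \<omega> (y, z)) \<and>
        ((\<lambda>t. bivariate_marginal W (t * x, t * y) / (t * (h t)\<^sup>2))
           \<longlongrightarrow> (LINT z:{0..}|lborel. \<omega> (x, z) * \<omega> (y, z))) at_top)) \<and>
    (\<forall>\<delta>>0. ((\<lambda>t. SUP (x, y)\<in>{(x, y). min x y \<ge> \<delta>}.
        ennreal \<bar>bivariate_marginal W (t * x, t * y) / (t * (h t)\<^sup>2)
                 - (LINT z:{0..}|lborel. \<omega> (x, z) * \<omega> (y, z))\<bar>) \<longlongrightarrow> 0) at_top)"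
proof -
  have "W \<in> borel_measurable (restrict_space borel ({0..} \<times> {0..}))"
    using assms(1) by (simp add: graphex_function_def)
  then interpret dominated_rescaling W \<omega> h "(\<alpha> + 1) / 2"
    using assms(3-8) by (rule graphex_dominated_rescaling)
  let ?I1 = "\<lambda>x. LINT y:{0..}|lborel. \<omega> (x, y)"
  let ?I2 = "\<lambda>x y. LINT z:{0..}|lborel. \<omega> (x, z) * \<omega> (y, z)"
  have h: "regularly_varying (-\<alpha>) h"
    and W_pos: "\<And>x z. x > 0 \<Longrightarrow> z \<ge> 0 \<Longrightarrow> W (x, z) > 0"
    and \<omega>_pos: "\<And>x z. x > 0 \<Longrightarrow> z \<ge> 0 \<Longrightarrow> \<omega> (x, z) > 0"
    using assms(4) by (auto simp: regularly_varying_on_def)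

  have \<mu>1_lim: "((\<lambda>t. univariate_marginal W (t * x) / (t * h t)) \<longlongrightarrow> ?I1 x) at_top" if "x > 0" for x
    using univariate_uniform_limit[OF that] by (intro tendsto_at_topI_abs_le) blast
  have \<mu>2_lim: "((\<lambda>t. bivariate_marginal W (t * x, t * y) / (t * (h t)\<^sup>2)) \<longlongrightarrow> ?I2 x y) at_top"
    if "x > 0" "y > 0" for x y
  proof (rule tendsto_at_topI_abs_le)
    fix \<eta> :: real assume "\<eta> > 0"
    with bivariate_uniform_limit[of "min x y" \<eta>] that
    show "\<exists>T. \<forall>t\<ge>T. \<bar>bivariate_marginal W (t * x, t * y) / (t * (h t)\<^sup>2) - ?I2 x y\<bar> \<le> \<eta>"
      by fastforce
  qed

  \<comment> \<open>The integral of a function that is not integrable is \<open>0\<close>, so positivity at every point needs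
    finiteness of the marginals at every point.\<close>
  have \<mu>1_pos: "univariate_marginal W x > 0" if "x > 0" for x
    unfolding univariate_marginal_def
  proof (intro set_integral_pos_half_line set_integrable_if_nn_integral_finite)
    show "(\<integral>\<^sup>+ z\<in>{0..}. ennreal (W (x, z)) \<partial>lborel) < \<infinity>"
      using assms(2) that by (simp add: finite_marginals_def)
  qed (use that in \<open>auto intro: W_pos W_meas less_imp_le\<close>)
  have \<mu>2_pos: "bivariate_marginal W (x, y) > 0" if "x > 0" "y > 0" for x y
    unfolding bivariate_marginal_def fst_conv snd_conv
  proof (intro set_integral_pos_half_line set_integrable_if_nn_integral_finite)
    show "(\<integral>\<^sup>+ z\<in>{0..}. ennreal (W (x, z) * W (y, z)) \<partial>lborel) < \<infinity>"
      using assms(2) that by (simp add: finite_marginals_def)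
    show "set_borel_measurable lborel {0..} (\<lambda>z. W (x, z) * W (y, z))"
      using that by (intro set_borel_measurable_mult_real W_meas) auto
  qed (use that in \<open>auto intro!: mult_pos_pos mult_nonneg_nonneg W_pos less_imp_le[OF W_pos]\<close>)

  have "?I1 1 > 0"
    by (intro set_integral_pos_half_line limit_section_integrable \<omega>_pos) auto
  moreover have "regularly_varying (-(\<alpha> - 1)) (\<lambda>t. t * h t)"
    using regularly_varying_mult_power[OF h, of 1] by (simp add: add.commute)
  ultimately have rv1: "regularly_varying (-(\<alpha> - 1)) (univariate_marginal W)"
    using \<mu>1_lim[of 1] \<mu>1_pos regularly_varying_equiv[of _ "\<lambda>t. t * h t" _ "?I1 1"]
    by simp

  have "regularly_varying (-(2 * \<alpha> - 1)) (\<lambda>t. t * (h t)\<^sup>2)"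
    using regularly_varying_mult_power[OF h, of 2] by (simp add: add.commute)
  moreover have "?I2 x y > 0" if "x > 0" "y > 0" for x y
    using that by (intro set_integral_pos_half_line limit_product_integrable mult_pos_pos \<omega>_pos)
  moreover have "nonneg_cone ({0<..} \<times> {0<..} :: (real \<times> real) set)"
    unfolding nonneg_cone_def
  proof (intro conjI subsetI allI iffI impI)
    fix p :: "real \<times> real" assume "\<forall>t>0. t *\<^sub>R p \<in> {0<..} \<times> {0<..}"
    from this[rule_format, of 1] show "p \<in> {0<..} \<times> {0<..}" by simp
  qed (auto simp: less_eq_prod_def)
  ultimately have rv2: "regularly_varying_on ({0<..} \<times> {0<..}) (bivariate_marginal W) (-(2 * \<alpha> - 1))
       (\<lambda>(x, y). ?I2 x y) (\<lambda>t. t * (h t)\<^sup>2)"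
    using \<mu>2_lim \<mu>2_pos unfolding regularly_varying_on_def by auto

  have "((\<lambda>t. SUP (x, y)\<in>{(x, y). min x y \<ge> \<delta>}.
        ennreal \<bar>bivariate_marginal W (t * x, t * y) / (t * (h t)\<^sup>2) - ?I2 x y\<bar>) \<longlongrightarrow> 0) at_top"
    if "\<delta> > 0" for \<delta>
  proof -
    have "((\<lambda>t. SUP p\<in>{(x, y). min x y \<ge> \<delta>}. ennreal (case p of (x, y) \<Rightarrow>
        \<bar>bivariate_marginal W (t * x, t * y) / (t * (h t)\<^sup>2) - ?I2 x y\<bar>)) \<longlongrightarrow> 0) at_top"
    proof (rule SUP_ennreal_tendsto_0I)
      fix \<eta> :: real assume "\<eta> > 0"
      from bivariate_uniform_limit[OF that this]
      show "\<exists>T. \<forall>t\<ge>T. \<forall>p\<in>{(x, y). min x y \<ge> \<delta>}. (case p of (x, y) \<Rightarrow>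
        \<bar>bivariate_marginal W (t * x, t * y) / (t * (h t)\<^sup>2) - ?I2 x y\<bar>) \<le> \<eta>"
        by auto
    qed
    then show ?thesis by (simp add: case_prod_unfold)
  qed
  with rv1 rv2 \<mu>1_lim \<mu>2_lim limit_section_integrable limit_product_integrable
  show ?thesis by blast
qed

end
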